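(* Let $\gamma$ be the Euler--Mascheroni constant and let $$C_{0}:=1+\left(2^{\frac32}-4e^{\frac{\gamma}{2}-1}\right)\left(\frac{2^{-1/2}e^{1-\frac{\gamma}{2}}}{2^{-1}-\log_{2}e^{1-\frac{\gamma}{2}}}+\left(1+2^{-\frac32}e^{1-\frac{\gamma}{2}}\right)\right).$$ The optimal multilinear Bohnenblust--Hille constants $(K_n)_{n=1}^\infty$ for real scalars satisfy $$K_{n}<\left(\frac{2^{\frac52}-8e^{-1+\frac{\gamma}{2}}}{2\log_{2}\left(e^{1-\frac{\gamma}{2}}\right)-1}\right)(n-1)^{\log_{2}\left(\frac{e^{1-\frac{\gamma}{2}}}{\sqrt{2}}\right)}+C_{0}$$ for all $n\ge2$. Numerically, $$K_{n}<1.65\,(n-1)^{0.526322}+0.13$$ for all $n\ge 2$.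
   Context: For a positive integer $n$, $K_n$ denotes the optimal constant in the real $n$-linear Bohnenblust--Hille inequality, i.e. the smallest $C\in[1,\infty)$ such that $$\left(\sum_{i_1,\ldots,i_n=1}^N |U(e_{i_1},\ldots,e_{i_n})|^{\frac{2n}{n+1}}\right)^{\frac{n+1}{2n}}\le C\,\sup|U(z_1,\ldots,z_n)|$$ for all positive integers $N$ and all $n$-linear forms $U:\mathbb{R}^N\times\cdots\times\mathbb{R}^N\to\mathbb{R}$, where $(e_i)_{i=1}^N$ is the canonical basis of $\mathbb{R}^N$ and the supremum is over all $z_1,\ldots,z_n$ in the open unit ball of $\mathbb{R}^N$ with the sup norm. Such finite constants exist (Bohnenblust--Hille theorem). The Euler--Mascheroni constant is $\gamma=\lim_{m\to\infty}\left(-\log m+\sum_{k=1}^m \frac1k\right)\approx0.5772$. *)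

theory Defs
  imports "HOL-Analysis.Analysis" "Jordan_Normal_Form.Matrix"
begin

(* Since N varies inside the definition of the constants, R^N is rendered as the carrier
   set carrier_vec N of the type real vec, and an n-tuple of vectors as an extensional
   function on {..<n}. Indices run from 0 instead of 1. *)

(* Only meaningful for N > 0; the Max of the empty set is unspecified. *)
definition sup_norm :: "real vec \<Rightarrow> real" where
  "sup_norm v = Max ((\<lambda>j. \<bar>vec_index v j\<bar>) ` {..<dim_vec v})"

definition unit_ball_sup :: "nat \<Rightarrow> real vec set" where
  "unit_ball_sup N = {v \<in> carrier_vec N. sup_norm v < 1}"

definition multilinear_form :: "nat \<Rightarrow> nat \<Rightarrow> ((nat \<Rightarrow> real vec) \<Rightarrow> real) \<Rightarrow> bool" where
  "multilinear_form n N U \<longleftrightarrow>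
     (\<forall>z \<in> {..<n} \<rightarrow>\<^sub>E carrier_vec N. \<forall>k<n. \<forall>v\<in>carrier_vec N. \<forall>w\<in>carrier_vec N. \<forall>a b.
        U (z(k := a \<cdot>\<^sub>v v + b \<cdot>\<^sub>v w)) = a * U (z(k := v)) + b * U (z(k := w)))"

definition BH_inequality :: "nat \<Rightarrow> real \<Rightarrow> bool" where
  "BH_inequality n C \<longleftrightarrow>
     (\<forall>N>0. \<forall>U. multilinear_form n N U \<longrightarrow>
        (\<Sum>i \<in> {..<n} \<rightarrow>\<^sub>E {..<N}.
            \<bar>U (\<lambda>k\<in>{..<n}. unit_vec N (i k))\<bar> powr (2 * real n / (real n + 1)))
          powr ((real n + 1) / (2 * real n))
        \<le> C * (SUP z \<in> {..<n} \<rightarrow>\<^sub>E unit_ball_sup N. \<bar>U z\<bar>))"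

definition BH_const :: "nat \<Rightarrow> real" where
  "BH_const n = (LEAST C. 1 \<le> C \<and> BH_inequality n C)"

definition C0 :: real where
  "C0 = (let \<gamma> = euler_mascheroni in
     1 + (2 powr (3/2) - 4 * exp (\<gamma>/2 - 1)) *
         (2 powr (-1/2) * exp (1 - \<gamma>/2) / (2 powr (-1) - log 2 (exp (1 - \<gamma>/2)))
          + (1 + 2 powr (-3/2) * exp (1 - \<gamma>/2))))"

end

theory Submission
  imports Defs "HOL-Probability.Probability"
begin

text \<open>
  The idea is to prove \<open>BH_const n \<le> B powr harm (n - 1)\<close> with \<open>B = 1.6\<close>. As
  \<open>ln 1.6 \<le> 1 / 2\<close>, this grows no faster than \<open>1.6 * sqrt (n - 1)\<close>, which is smaller than both bounds
  of the theorem: their exponents exceed \<open>1 / 2\<close>, their leading coefficients exceed \<open>1.6\<close> and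
  their constant terms are positive (\<open>bound_parameters\<close>).

  The estimate comes from an induction on the number of slots of the form
  (\<open>coeff_Bohnenblust_Hille\<close>). Two inequalities carry the step from \<open>d\<close> to \<open>d + 1\<close> slots. The first,
  \<open>mixed_norm_interpolation\<close>, bounds the norm of the coefficients of order \<open>2 (d + 1) / (d + 2)\<close> by the
  geometric mean of \<open>d + 1\<close> mixed norms, which are Euclidean in one index and of order
  \<open>p = 2 d / (d + 1)\<close> in the others; it follows from Hoelder's inequality and the
  Loomis--Whitney inequality. The second is Khinchine's inequality: it replaces the
  Euclidean norm in one index by the average over a vector of random signs put into
  this slot, and the induction hypothesis applies to the remaining form with \<open>d\<close> slots.

  The growth of the constants is governed by the constant in Khinchine's inequality for \<open>p\<close> close to
  2. It is obtained here by interpolating the second moment of a random sum between the moments of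
  order \<open>p\<close> and 3. The third absolute moment of a normalised random sum is at most that of a standard
  Gaussian variable, which is \<open>2 * sqrt (2 / pi) \<le> 1.6\<close>. The comparison replaces the random
  signs by Gaussian variables one by one; it works because \<open>\<bar>y + v\<bar>^3 + \<bar>y - v\<bar>^3\<close> is a
  convex function of \<open>v^2\<close>.
\<close>

section \<open>Averages, Hoelder's inequality and the Loomis--Whitney inequality\<close>

text \<open>
  Averages rather than sums are used for sign vectors and for index tuples alike: averaging over
  a coordinate fixes every function that does not depend on that coordinate, so no powers of
  the side length have to be carried along.
\<close>
definition mean :: "'a set \<Rightarrow> ('a \<Rightarrow> real) \<Rightarrow> real" where
  "mean S f = (\<Sum>x\<in>S. f x) / real (card S)"

lemma mean_mono: "(\<And>x. x \<in> S \<Longrightarrow> f x \<le> g x) \<Longrightarrow> mean S f \<le> mean S g"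
  unfolding mean_def by (intro divide_right_mono sum_mono) auto

lemma mean_nonneg: "(\<And>x. x \<in> S \<Longrightarrow> 0 \<le> f x) \<Longrightarrow> 0 \<le> mean S f"
  unfolding mean_def by (intro divide_nonneg_nonneg sum_nonneg) auto

lemma mean_const: "finite S \<Longrightarrow> S \<noteq> {} \<Longrightarrow> mean S (\<lambda>x. c) = c"
  unfolding mean_def by simp

lemma mean_add: "mean S (\<lambda>x. f x + g x) = mean S f + mean S g"
  unfolding mean_def by (simp add: sum.distrib add_divide_distrib)

lemma mean_cmult: "mean S (\<lambda>x. c * f x) = c * mean S f"
  unfolding mean_def by (simp add: sum_distrib_left)

lemma mean_sum: "mean S (\<lambda>x. \<Sum>i\<in>I. f i x) = (\<Sum>i\<in>I. mean S (f i))"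
  unfolding mean_def by (subst sum.swap) (simp add: sum_divide_distrib)

lemma mean_le:
  assumes "finite S" "S \<noteq> {}" "\<And>x. x \<in> S \<Longrightarrow> f x \<le> c"
  shows "mean S f \<le> c"
  using mean_mono[of S f "\<lambda>_. c"] assms by (simp add: mean_const)

lemma sum_PiE_insert:
  assumes "finite J" "j \<notin> J"
  shows "(\<Sum>x\<in>Pi\<^sub>E (insert j J) A. f x) = (\<Sum>x\<in>Pi\<^sub>E J A. \<Sum>t\<in>A j. f (x(j := t)))"
proof -
  have "(\<Sum>x\<in>Pi\<^sub>E (insert j J) A. f x) = (\<Sum>y\<in>A j \<times> Pi\<^sub>E J A. f (case y of (t, x) \<Rightarrow> x(j := t)))"
    unfolding PiE_insert_eq
    by (subst sum.reindex[OF inj_combinator[OF assms(2)]]) simp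
  also have "\<dots> = (\<Sum>t\<in>A j. \<Sum>x\<in>Pi\<^sub>E J A. f (x(j := t)))"
    by (simp add: sum.cartesian_product case_prod_unfold)
  also have "\<dots> = (\<Sum>x\<in>Pi\<^sub>E J A. \<Sum>t\<in>A j. f (x(j := t)))"
    by (rule sum.swap)
  finally show ?thesis .
qed

lemma mean_PiE_insert:
  assumes "finite J" "j \<notin> J"
  shows "mean (Pi\<^sub>E (insert j J) A) f = mean (Pi\<^sub>E J A) (\<lambda>x. mean (A j) (\<lambda>t. f (x(j := t))))"
  using assms unfolding mean_def sum_PiE_insert[OF assms]
  by (simp add: card_PiE sum_divide_distrib)

lemma mean_PiE_insert':
  assumes "finite J" "j \<notin> J"
  shows "mean (Pi\<^sub>E (insert j J) A) f = mean (A j) (\<lambda>t. mean (Pi\<^sub>E J A) (\<lambda>x. f (x(j := t))))"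
  using assms unfolding mean_def sum_PiE_insert[OF assms]
  by (subst sum.swap) (simp add: card_PiE sum_divide_distrib mult.commute)

text \<open>
  After dividing each \<open>u k\<close> by its sum over \<open>S\<close>, this is the arithmetic-geometric mean inequality
  applied at each point \<open>x\<close> and then summed over \<open>x\<close>.
\<close>
lemma Holder_sum_prod:
  fixes u :: "'k \<Rightarrow> 'a \<Rightarrow> real"
  assumes K: "finite K" "K \<noteq> {}" and S: "finite S"
    and u: "\<And>k x. k \<in> K \<Longrightarrow> x \<in> S \<Longrightarrow> 0 \<le> u k x"
  shows "(\<Sum>x\<in>S. (\<Prod>k\<in>K. u k x) powr (1 / card K)) \<le> (\<Prod>k\<in>K. \<Sum>x\<in>S. u k x) powr (1 / card K)"
proof (cases "\<exists>k\<in>K. (\<Sum>x\<in>S. u k x) = 0")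
  case True
  then obtain k where k: "k \<in> K" "(\<Sum>x\<in>S. u k x) = 0" by blast
  then have "u k x = 0" if "x \<in> S" for x
    using that u S by (simp add: sum_nonneg_eq_0_iff)
  then have "(\<Prod>k\<in>K. u k x) = 0" if "x \<in> S" for x
    using that k(1) K(1) by auto
  then show ?thesis by simp
next
  case False
  define s where "s k = (\<Sum>x\<in>S. u k x)" for k
  have s: "s k > 0" if "k \<in> K" for k
    using False that u sum_nonneg[of S "u k"] by (force simp: s_def less_le)
  define P where "P = (\<Prod>k\<in>K. s k)"
  have P: "P > 0" unfolding P_def by (intro prod_pos) (use s in auto)
  have c: "card K > 0" using K by (simp add: card_gt_0_iff)
  have "(\<Prod>k\<in>K. u k x) powr (1 / card K) \<le> P powr (1 / card K) * (\<Sum>k\<in>K. u k x / s k / card K)"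
    if "x \<in> S" for x
  proof -
    have "(\<Prod>k\<in>K. u k x) = P * (\<Prod>k\<in>K. u k x / s k)"
      using P by (simp add: P_def prod_dividef)
    moreover have "(\<Prod>k\<in>K. u k x / s k) \<ge> 0"
      using s u that by (intro prod_nonneg) (simp add: less_imp_le)
    ultimately have "(\<Prod>k\<in>K. u k x) powr (1 / card K)
        = P powr (1 / card K) * (\<Prod>k\<in>K. u k x / s k) powr (1 / card K)"
      using P by (simp add: powr_mult)
    also have "\<dots> \<le> P powr (1 / card K) * (\<Sum>k\<in>K. u k x / s k / card K)"
      using arith_geom_mean[OF K, of "\<lambda>k. u k x / s k"] u s that
      by (intro mult_left_mono) (simp_all add: less_imp_le)
    finally show ?thesis .
  qed
  then have "(\<Sum>x\<in>S. (\<Prod>k\<in>K. u k x) powr (1 / card K))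
      \<le> (\<Sum>x\<in>S. P powr (1 / card K) * (\<Sum>k\<in>K. u k x / s k / card K))"
    by (intro sum_mono) auto
  also have "\<dots> = P powr (1 / card K) * (\<Sum>k\<in>K. (\<Sum>x\<in>S. u k x) / s k / card K)"
    unfolding sum_distrib_left [symmetric]
    by (subst sum.swap) (simp add: sum_divide_distrib)
  also have "(\<Sum>k\<in>K. (\<Sum>x\<in>S. u k x) / s k / card K) = (\<Sum>k\<in>K. 1 / card K)"
  proof (rule sum.cong)
    show "(\<Sum>x\<in>S. u k x) / s k / card K = 1 / card K" if "k \<in> K" for k
      using s[OF that] by (simp flip: s_def)
  qed simp
  also have "\<dots> = 1" using c by simp
  finally show ?thesis by (simp add: P_def s_def)
qed

lemma Holder_mean_prod:
  fixes u :: "'k \<Rightarrow> 'a \<Rightarrow> real"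
  assumes K: "finite K" "K \<noteq> {}" and S: "finite S" "S \<noteq> {}"
    and u: "\<And>k x. k \<in> K \<Longrightarrow> x \<in> S \<Longrightarrow> 0 \<le> u k x"
  shows "mean S (\<lambda>x. (\<Prod>k\<in>K. u k x) powr (1 / card K)) \<le> (\<Prod>k\<in>K. mean S (u k)) powr (1 / card K)"
proof -
  have c: "card K > 0" "card S > 0" using K S by (auto simp: card_gt_0_iff)
  have "(\<Prod>k\<in>K. mean S (u k)) powr (1 / card K)
      = (\<Prod>k\<in>K. \<Sum>x\<in>S. u k x) powr (1 / card K) / (real (card S) ^ card K) powr (1 / card K)"
    unfolding mean_def prod_dividef
    by (subst powr_divide) (auto intro!: prod_nonneg sum_nonneg u)
  also have "(real (card S) ^ card K) powr (1 / card K) = card S"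
    using c by (simp add: powr_powr flip: powr_realpow)
  finally show ?thesis
    using Holder_sum_prod[OF K S(1) u] by (simp add: mean_def divide_right_mono)
qed

text \<open>
  A functional form of the Loomis--Whitney inequality. The coordinates are averaged out one at a
  time. In each of them one of the \<open>d + 1\<close> factors is constant and can be taken out of the average;
  Hoelder's inequality with the exponent \<open>d\<close> for each of the other \<open>d\<close> factors then moves the average
  inside the product. The factors are arbitrary functions of the whole tuple whose independence of
  a coordinate is a hypothesis, because this survives the averaging of other coordinates and
  makes the induction over the set of coordinates go through.
\<close>
lemma Loomis_Whitney_mean:
  fixes h :: "'k \<Rightarrow> ('j \<Rightarrow> 'a) \<Rightarrow> real"
  assumes "finite J" and K: "finite K" "card K = Suc d" "d > 0"
    and A: "\<And>j. finite (A j)" "\<And>j. A j \<noteq> {}"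
    and h: "\<And>k x. k \<in> K \<Longrightarrow> 0 \<le> h k x"
    and indep: "\<And>j. j \<in> J \<Longrightarrow> \<exists>k\<in>K. \<forall>x t. h k (x(j := t)) = h k x"
  shows "mean (Pi\<^sub>E J A) (\<lambda>x. (\<Prod>k\<in>K. h k x) powr (1 / d))
       \<le> (\<Prod>k\<in>K. mean (Pi\<^sub>E J A) (h k)) powr (1 / d)"
  using assms(1) h indep
proof (induction J arbitrary: h rule: finite_induct)
  case empty
  then show ?case by (simp add: mean_def)
next
  case (insert j J)
  define h' where "h' k x = mean (A j) (\<lambda>t. h k (x(j := t)))" for k x
  have h'_nonneg: "0 \<le> h' k x" if "k \<in> K" for k x
    unfolding h'_def using insert.prems(1) that by (intro mean_nonneg)
  have h'_indep: "\<exists>k\<in>K. \<forall>x t. h' k (x(i := t)) = h' k x" if i: "i \<in> J" for i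
  proof -
    obtain k where k: "k \<in> K" "\<And>x t. h k (x(i := t)) = h k x"
      using insert.prems(2)[OF insertI2[OF i]] by blast
    have "i \<noteq> j" using i insert.hyps by auto
    then have "h k (x(i := t, j := u)) = h k (x(j := u))" for x t u
      using k(2)[of "x(j := u)" t] by (simp add: fun_upd_twist)
    then have "h' k (x(i := t)) = h' k x" for x t
      unfolding h'_def by simp
    then show ?thesis using k(1) by blast
  qed
  have step: "mean (A j) (\<lambda>t. (\<Prod>k\<in>K. h k (x(j := t))) powr (1 / d)) \<le> (\<Prod>k\<in>K. h' k x) powr (1 / d)" for x
  proof -
    \<comment> \<open>The factor that is constant in the coordinate \<open>j\<close>; it is its own average.\<close>
    obtain l where l: "l \<in> K" "\<And>x t. h l (x(j := t)) = h l x"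
      using insert.prems(2)[OF insertI1] by blast
    have K': "finite (K - {l})" "card (K - {l}) = d"
      using K l(1) by (simp_all add: card_Diff_singleton)
    then have ne: "K - {l} \<noteq> {}" using K(3) by (metis card.empty less_irrefl)
    have h'l: "h' l x = h l x"
      unfolding h'_def l(2) by (rule mean_const[OF A])
    have pd: "(\<Prod>k\<in>K. f k) powr (1 / d) = f l powr (1 / d) * (\<Prod>k\<in>K - {l}. f k) powr (1 / d)"
      if "\<And>k. k \<in> K \<Longrightarrow> f k \<ge> 0" for f :: "'k \<Rightarrow> real"
      using that l(1) K(1) by (subst prod.remove[of _ l]) (auto simp: powr_mult prod_nonneg)
    have "mean (A j) (\<lambda>t. (\<Prod>k\<in>K. h k (x(j := t))) powr (1 / d))
        = h l x powr (1 / d) * mean (A j) (\<lambda>t. (\<Prod>k\<in>K - {l}. h k (x(j := t))) powr (1 / d))"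
      using insert.prems(1) by (subst pd) (auto simp: l(2) mean_cmult)
    also have "\<dots> \<le> h l x powr (1 / d) * (\<Prod>k\<in>K - {l}. h' k x) powr (1 / d)"
      using Holder_mean_prod[OF K'(1) ne A, of j "\<lambda>k t. h k (x(j := t))"] insert.prems(1)
      by (intro mult_left_mono) (auto simp: K'(2) h'_def)
    also have "\<dots> = (\<Prod>k\<in>K. h' k x) powr (1 / d)"
      using h'_nonneg by (subst pd) (auto simp: h'l)
    finally show ?thesis .
  qed
  have "mean (Pi\<^sub>E (insert j J) A) (\<lambda>x. (\<Prod>k\<in>K. h k x) powr (1 / d))
      \<le> mean (Pi\<^sub>E J A) (\<lambda>x. (\<Prod>k\<in>K. h' k x) powr (1 / d))"
    unfolding mean_PiE_insert[OF insert.hyps] by (intro mean_mono step)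
  also have "\<dots> \<le> (\<Prod>k\<in>K. mean (Pi\<^sub>E J A) (h' k)) powr (1 / d)"
    by (intro insert.IH h'_nonneg h'_indep)
  finally show ?case
    unfolding mean_PiE_insert[OF insert.hyps] h'_def .
qed

section \<open>Comparison of a random sign with a Gaussian variable\<close>

text \<open>
  Both branches agree with \<open>2 * max (\<bar>y\<bar>^3 + 3 * \<bar>y\<bar> * v^2) (\<bar>v\<bar>^3 + 3 * y^2 * \<bar>v\<bar>)\<close>, since the
  two expressions differ by \<open>(\<bar>y\<bar> - \<bar>v\<bar>)^3\<close>.
\<close>
lemma sum_abs_cubes:
  fixes y v :: real
  shows "\<bar>y + v\<bar> ^ 3 + \<bar>y - v\<bar> ^ 3 =
    (if \<bar>v\<bar> \<le> \<bar>y\<bar> then 2 * \<bar>y\<bar> ^ 3 + 6 * \<bar>y\<bar> * v\<^sup>2 else 2 * \<bar>v\<bar> ^ 3 + 6 * y\<^sup>2 * \<bar>v\<bar>)"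
proof -
  have pos: "\<bar>y + v\<bar> ^ 3 + \<bar>y - v\<bar> ^ 3 =
    (if v \<le> y then 2 * y ^ 3 + 6 * y * v\<^sup>2 else 2 * v ^ 3 + 6 * y\<^sup>2 * v)"
    if "y \<ge> 0" "v \<ge> 0" for y v :: real
    using that by (auto simp: abs_if power3_eq_cube power2_eq_square algebra_simps)
  have "\<bar>y + v\<bar> ^ 3 + \<bar>y - v\<bar> ^ 3 = \<bar>\<bar>y\<bar> + \<bar>v\<bar>\<bar> ^ 3 + \<bar>\<bar>y\<bar> - \<bar>v\<bar>\<bar> ^ 3"
  proof (cases "(y \<ge> 0) = (v \<ge> 0)")
    case True
    then have "\<bar>y + v\<bar> = \<bar>\<bar>y\<bar> + \<bar>v\<bar>\<bar>" "\<bar>y - v\<bar> = \<bar>\<bar>y\<bar> - \<bar>v\<bar>\<bar>" by arith+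
    then show ?thesis by simp
  next
    case False
    then have "\<bar>y + v\<bar> = \<bar>\<bar>y\<bar> - \<bar>v\<bar>\<bar>" "\<bar>y - v\<bar> = \<bar>\<bar>y\<bar> + \<bar>v\<bar>\<bar>" by arith+
    then show ?thesis by simp
  qed
  then show ?thesis using pos[of "\<bar>y\<bar>" "\<bar>v\<bar>"] by simp
qed

text \<open>
  The function \<open>\<bar>y + a g\<bar>^3 + \<bar>y - a g\<bar>^3\<close> is convex in \<open>g^2\<close>, and so lies above its tangent line
  at \<open>g^2 = 1\<close>; \<open>c\<close> is the slope of this line. Under any distribution of \<open>g\<close> with \<open>E g^2 = 1\<close> the terms
  with \<open>c\<close> cancel, which is how a random sign is compared with a Gaussian variable.
\<close>
lemma cube_tangent_at_1:
  fixes y a :: real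
  obtains c where "c \<ge> 0"
    "\<And>g. \<bar>y + a\<bar> ^ 3 + \<bar>y - a\<bar> ^ 3 + c * g\<^sup>2 \<le> \<bar>y + a * g\<bar> ^ 3 + \<bar>y - a * g\<bar> ^ 3 + c"
proof (cases "\<bar>a\<bar> \<le> \<bar>y\<bar>")
  case True
  define c where "c = 6 * \<bar>y\<bar> * a\<^sup>2"
  have "\<bar>y + a\<bar> ^ 3 + \<bar>y - a\<bar> ^ 3 + c * g\<^sup>2 \<le> \<bar>y + a * g\<bar> ^ 3 + \<bar>y - a * g\<bar> ^ 3 + c" for g
  proof (cases "\<bar>a * g\<bar> \<le> \<bar>y\<bar>")
    case True
    then show ?thesis unfolding sum_abs_cubes using \<open>\<bar>a\<bar> \<le> \<bar>y\<bar>\<close> by (simp add: c_def power_mult_distrib)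
  next
    case False
    define u Y where "u = \<bar>a * g\<bar>" and "Y = \<bar>y\<bar>"
    have "0 \<le> (u - Y) ^ 3" using False by (simp add: u_def Y_def)
    then have "2 * Y ^ 3 + 6 * Y * u\<^sup>2 \<le> 2 * u ^ 3 + 6 * Y\<^sup>2 * u"
      by (simp add: power3_eq_cube power2_eq_square algebra_simps)
    moreover have "u\<^sup>2 = a\<^sup>2 * g\<^sup>2" "Y\<^sup>2 = y\<^sup>2" by (simp_all add: u_def Y_def power_mult_distrib)
    ultimately show ?thesis unfolding sum_abs_cubes using \<open>\<bar>a\<bar> \<le> \<bar>y\<bar>\<close> False
      by (simp add: c_def flip: u_def Y_def)
  qed
  moreover have "c \<ge> 0" by (simp add: c_def)
  ultimately show ?thesis using that by blast
next
  case False
  define A Y where "A = \<bar>a\<bar>" and "Y = \<bar>y\<bar>"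
  have AY: "0 \<le> Y" "Y < A" using False by (simp_all add: A_def Y_def)
  define c where "c = 3 * A ^ 3 + 3 * Y\<^sup>2 * A"
  have "\<bar>y + a\<bar> ^ 3 + \<bar>y - a\<bar> ^ 3 + c * g\<^sup>2 \<le> \<bar>y + a * g\<bar> ^ 3 + \<bar>y - a * g\<bar> ^ 3 + c" for g
  proof -
    define h where "h = \<bar>g\<bar>"
    have h: "h \<ge> 0" "h\<^sup>2 = g\<^sup>2" by (simp_all add: h_def)
    have l: "\<bar>y + a\<bar> ^ 3 + \<bar>y - a\<bar> ^ 3 = 2 * A ^ 3 + 6 * Y\<^sup>2 * A"
      unfolding sum_abs_cubes using False by (simp add: A_def Y_def)
    have r: "\<bar>y + a * g\<bar> ^ 3 + \<bar>y - a * g\<bar> ^ 3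
        = (if A * h \<le> Y then 2 * Y ^ 3 + 6 * Y * (A * h)\<^sup>2 else 2 * (A * h) ^ 3 + 6 * Y\<^sup>2 * (A * h))"
      unfolding sum_abs_cubes by (simp add: A_def Y_def h_def abs_mult power_mult_distrib)
    show ?thesis
    proof (cases "A * h \<le> Y")
      case True
      \<comment> \<open>The two sides differ by \<open>(A - Y)^2 * (A + 2 * Y - 3 * A * h^2)\<close>.\<close>
      have "(A * h)\<^sup>2 \<le> Y\<^sup>2" using True AY h by (intro power_mono) auto
      moreover have "0 \<le> (A + 3 * Y) * (A - Y)" using AY by (intro mult_nonneg_nonneg) auto
      ultimately have "0 \<le> A * (A + 2 * Y - 3 * A * h\<^sup>2)"
        by (simp add: algebra_simps power2_eq_square)
      then have "0 \<le> A + 2 * Y - 3 * A * h\<^sup>2" using AY by (simp add: zero_le_mult_iff)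
      then have "0 \<le> (A - Y)\<^sup>2 * (A + 2 * Y - 3 * A * h\<^sup>2)" by (intro mult_nonneg_nonneg) auto
      then show ?thesis unfolding l r h(2) [symmetric] using True
        by (simp add: c_def power3_eq_cube power2_eq_square algebra_simps)
    next
      case False
      \<comment> \<open>The two sides differ by \<open>A * (h - 1)^2 * (A^2 * (2 * h + 1) - 3 * Y^2)\<close>.\<close>
      have "Y * Y \<le> A * (A * h)" using AY False by (intro mult_mono) auto
      moreover have "Y * Y \<le> A * A" using AY by (intro mult_mono) auto
      ultimately have "0 \<le> A\<^sup>2 * (2 * h + 1) - 3 * Y\<^sup>2"
        by (simp add: power2_eq_square algebra_simps)
      then have "0 \<le> A * (h - 1)\<^sup>2 * (A\<^sup>2 * (2 * h + 1) - 3 * Y\<^sup>2)"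
        using AY by (intro mult_nonneg_nonneg) auto
      then show ?thesis unfolding l r h(2) [symmetric] using False
        by (simp add: c_def power3_eq_cube power2_eq_square algebra_simps)
    qed
  qed
  moreover have "c \<ge> 0" using AY by (simp add: c_def)
  ultimately show ?thesis using that by blast
qed

text \<open>
  The expectation of \<open>f (x + s g)\<close> for a standard Gaussian variable \<open>g\<close>. Values in
  \<open>[0, \<infinity>]\<close> avoid all integrability conditions when integrals are exchanged.
\<close>
definition gauss_mean :: "(real \<Rightarrow> ennreal) \<Rightarrow> real \<Rightarrow> real \<Rightarrow> ennreal" where
  "gauss_mean f x s = (\<integral>\<^sup>+g. ennreal (std_normal_density g) * f (x + s * g) \<partial>lborel)"

lemma nn_integral_std_normal_density: "(\<integral>\<^sup>+g. ennreal (std_normal_density g) \<partial>lborel) = 1"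
  by (subst nn_integral_eq_integral) auto

lemma gauss_mean_0: "gauss_mean f x 0 = f x"
  unfolding gauss_mean_def by (simp add: nn_integral_multc nn_integral_std_normal_density)

lemma gauss_mean_normal_density:
  assumes [measurable]: "f \<in> borel_measurable borel" and s: "s \<noteq> 0"
  shows "gauss_mean f x s = (\<integral>\<^sup>+y. ennreal (normal_density 0 \<bar>s\<bar> y) * f (x + y) \<partial>lborel)"
proof -
  have dens: "\<bar>s\<bar> * normal_density 0 \<bar>s\<bar> (s * g) = std_normal_density g" for g
    using s by (simp add: normal_density_def power_mult_distrib real_sqrt_mult)
  have "(\<integral>\<^sup>+y. ennreal (normal_density 0 \<bar>s\<bar> y) * f (x + y) \<partial>lborel)
      = \<bar>s\<bar> * (\<integral>\<^sup>+g. ennreal (normal_density 0 \<bar>s\<bar> (s * g)) * f (x + s * g) \<partial>lborel)"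
    using s by (subst nn_integral_real_affine[where c = s and t = 0]) auto
  also have "\<dots> = (\<integral>\<^sup>+g. ennreal (\<bar>s\<bar> * normal_density 0 \<bar>s\<bar> (s * g)) * f (x + s * g) \<partial>lborel)"
    by (subst nn_integral_cmult [symmetric]) (auto simp: ennreal_mult' mult.assoc)
  finally show ?thesis by (simp add: dens gauss_mean_def)
qed

lemma borel_measurable_gauss_mean [measurable]:
  assumes [measurable]: "f \<in> borel_measurable borel"
  shows "(\<lambda>x. gauss_mean f x s) \<in> borel_measurable borel"
  unfolding gauss_mean_def by measurable

text \<open>
  The sum of independent centred Gaussian variables is Gaussian, and the variances add up.
\<close>
lemma gauss_mean_gauss_mean:
  assumes [measurable]: "f \<in> borel_measurable borel"
  shows "gauss_mean (\<lambda>y. gauss_mean f y s) x b = gauss_mean f x (sqrt (s\<^sup>2 + b\<^sup>2))"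
proof -
  have sym: "gauss_mean f x \<bar>c\<bar> = gauss_mean f x c" for c
    by (cases "c = 0") (simp_all add: gauss_mean_normal_density)
  consider "s = 0" | "b = 0" | "s \<noteq> 0" "b \<noteq> 0" by blast
  then show ?thesis
  proof cases
    case 3
    define n where "n = normal_density 0"
    have [measurable]: "n c \<in> borel_measurable borel" for c by (simp add: n_def)
    have nn [simp]: "n c x \<ge> 0" for c x by (simp add: n_def)
    have "gauss_mean (\<lambda>y. gauss_mean f y s) x b
        = (\<integral>\<^sup>+y. ennreal (n \<bar>b\<bar> y) * (\<integral>\<^sup>+z. ennreal (n \<bar>s\<bar> z) * f (x + y + z) \<partial>lborel) \<partial>lborel)"
      using 3 by (simp add: gauss_mean_normal_density n_def)
    also have "\<dots> = (\<integral>\<^sup>+y. ennreal (n \<bar>b\<bar> y) * (\<integral>\<^sup>+w. ennreal (n \<bar>s\<bar> (w - y)) * f (x + w) \<partial>lborel) \<partial>lborel)"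
    proof (rule nn_integral_cong)
      fix y
      show "ennreal (n \<bar>b\<bar> y) * (\<integral>\<^sup>+z. ennreal (n \<bar>s\<bar> z) * f (x + y + z) \<partial>lborel)
          = ennreal (n \<bar>b\<bar> y) * (\<integral>\<^sup>+w. ennreal (n \<bar>s\<bar> (w - y)) * f (x + w) \<partial>lborel)"
        by (subst (2) nn_integral_real_affine[where c = 1 and t = y]) (auto simp: add.assoc)
    qed
    also have "\<dots> = (\<integral>\<^sup>+y. (\<integral>\<^sup>+w. ennreal (n \<bar>s\<bar> (w - y) * n \<bar>b\<bar> y) * f (x + w) \<partial>lborel) \<partial>lborel)"
      by (subst nn_integral_cmult [symmetric]) (auto simp: ennreal_mult' ac_simps)
    also have "\<dots> = (\<integral>\<^sup>+w. (\<integral>\<^sup>+y. ennreal (n \<bar>s\<bar> (w - y) * n \<bar>b\<bar> y) * f (x + w) \<partial>lborel) \<partial>lborel)"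
      by (rule lborel_pair.Fubini') measurable
    also have "\<dots> = (\<integral>\<^sup>+w. (\<integral>\<^sup>+y. ennreal (n \<bar>s\<bar> (w - y) * n \<bar>b\<bar> y) \<partial>lborel) * f (x + w) \<partial>lborel)"
      by (subst nn_integral_multc) auto
    also have "\<dots> = (\<integral>\<^sup>+w. ennreal (n (sqrt (s\<^sup>2 + b\<^sup>2)) w) * f (x + w) \<partial>lborel)"
      using 3 fun_cong[OF conv_normal_density_zero_mean[of "\<bar>s\<bar>" "\<bar>b\<bar>"]] by (simp add: n_def)
    also have "\<dots> = gauss_mean f x (sqrt (s\<^sup>2 + b\<^sup>2))"
      using 3 by (subst gauss_mean_normal_density) (auto simp: n_def sum_power2_eq_zero_iff)
    finally show ?thesis .
  qed (simp_all add: gauss_mean_0 sym)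
qed

text \<open>
  Integration of the tangent inequality against the Gaussian density, whose second moment is 1.
  The two cubes on the right have the same integral, by reflection.
\<close>
lemma two_point_le_gauss_mean:
  fixes y a :: real
  shows "ennreal (\<bar>y + a\<bar> ^ 3 + \<bar>y - a\<bar> ^ 3) \<le> 2 * gauss_mean (\<lambda>u. ennreal (\<bar>u\<bar> ^ 3)) y a"
    (is "_ \<le> 2 * ?G")
proof -
  obtain c where c: "c \<ge> 0"
    "\<And>g. \<bar>y + a\<bar> ^ 3 + \<bar>y - a\<bar> ^ 3 + c * g\<^sup>2 \<le> \<bar>y + a * g\<bar> ^ 3 + \<bar>y - a * g\<bar> ^ 3 + c"
    using cube_tangent_at_1[of y a] by blast
  define L where "L = \<bar>y + a\<bar> ^ 3 + \<bar>y - a\<bar> ^ 3"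
  have L: "L \<ge> 0" by (simp add: L_def)
  define \<phi> where "\<phi> = std_normal_density"
  have \<phi> [simp]: "\<phi> g \<ge> 0" for g by (simp add: \<phi>_def)
  have [measurable]: "\<phi> \<in> borel_measurable borel" by (simp add: \<phi>_def)
  have m0: "(\<integral>\<^sup>+g. ennreal (\<phi> g) \<partial>lborel) = 1"
    by (simp add: \<phi>_def nn_integral_std_normal_density)
  have "has_bochner_integral lborel (\<lambda>g. \<phi> g * g\<^sup>2) 1"
    using std_normal_moment_even[of 1] by (simp add: \<phi>_def)
  then have m2: "(\<integral>\<^sup>+g. ennreal (\<phi> g * g\<^sup>2) \<partial>lborel) = 1"
    by (subst nn_integral_eq_integral) (auto simp: has_bochner_integral_iff)
  have refl: "(\<integral>\<^sup>+g. ennreal (\<phi> g * \<bar>y - a * g\<bar> ^ 3) \<partial>lborel) = (\<integral>\<^sup>+g. ennreal (\<phi> g * \<bar>y + a * g\<bar> ^ 3) \<partial>lborel)"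
    by (subst nn_integral_real_affine[where c = "-1" and t = 0]) (auto simp: \<phi>_def std_normal_density_def)
  have G: "(\<integral>\<^sup>+g. ennreal (\<phi> g * \<bar>y + a * g\<bar> ^ 3) \<partial>lborel) = ?G"
    by (simp add: gauss_mean_def \<phi>_def ennreal_mult')
  \<comment> \<open>The constant \<open>c\<close> is kept on both sides so that all integrands are nonnegative.\<close>
  have "ennreal (L + c) = ennreal L * (\<integral>\<^sup>+g. ennreal (\<phi> g) \<partial>lborel) + ennreal c * (\<integral>\<^sup>+g. ennreal (\<phi> g * g\<^sup>2) \<partial>lborel)"
    using L c(1) by (simp add: m0 m2 ennreal_plus)
  also have "\<dots> = (\<integral>\<^sup>+g. ennreal (\<phi> g * (L + c * g\<^sup>2)) \<partial>lborel)"
    using L c(1)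
    by (simp add: distrib_left ennreal_plus nn_integral_add flip: nn_integral_cmult)
       (simp add: ac_simps flip: ennreal_mult')
  also have "\<dots> \<le> (\<integral>\<^sup>+g. ennreal (\<phi> g * (\<bar>y + a * g\<bar> ^ 3 + \<bar>y - a * g\<bar> ^ 3 + c)) \<partial>lborel)"
    using c(2) by (intro nn_integral_mono ennreal_leI mult_left_mono) (auto simp: L_def)
  also have "\<dots> = (\<integral>\<^sup>+g. ennreal (\<phi> g * \<bar>y + a * g\<bar> ^ 3) \<partial>lborel)
       + (\<integral>\<^sup>+g. ennreal (\<phi> g * \<bar>y - a * g\<bar> ^ 3) \<partial>lborel) + (\<integral>\<^sup>+g. ennreal (\<phi> g) * ennreal c \<partial>lborel)"
    using c(1) by (simp add: distrib_left ennreal_plus nn_integral_add ennreal_mult')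
  also have "\<dots> = 2 * ?G + ennreal c"
    unfolding refl G by (simp add: nn_integral_multc m0 mult_2)
  finally have "ennreal L + ennreal c \<le> 2 * ?G + ennreal c"
    using L c(1) by (simp add: ennreal_plus)
  then show ?thesis by (simp add: L_def)
qed

section \<open>Khinchine's inequality\<close>

lemma two_point_gauss_mean_le:
  fixes a s x :: real
  defines "G \<equiv> gauss_mean (\<lambda>u. ennreal (\<bar>u\<bar> ^ 3))"
  shows "G (x + a) s + G (x - a) s \<le> 2 * G x (sqrt (a\<^sup>2 + s\<^sup>2))"
proof -
  define c :: "real \<Rightarrow> ennreal" where "c = (\<lambda>u. ennreal (\<bar>u\<bar> ^ 3))"
  have [measurable]: "c \<in> borel_measurable borel" unfolding c_def by measurable
  have "G (x + a) s + G (x - a) s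
      = (\<integral>\<^sup>+g. ennreal (std_normal_density g) * (c ((x + s * g) + a) + c ((x + s * g) - a)) \<partial>lborel)"
    unfolding G_def gauss_mean_def c_def [symmetric]
    by (subst nn_integral_add [symmetric]) (auto simp: algebra_simps)
  also have "\<dots> \<le> (\<integral>\<^sup>+g. ennreal (std_normal_density g) * (2 * gauss_mean c (x + s * g) a) \<partial>lborel)"
    unfolding c_def using two_point_le_gauss_mean
    by (intro nn_integral_mono mult_left_mono) (auto simp: ennreal_plus)
  also have "\<dots> = 2 * gauss_mean (\<lambda>y. gauss_mean c y a) x s"
    unfolding gauss_mean_def [of "\<lambda>y. gauss_mean c y a"]
    by (subst nn_integral_cmult [symmetric]) (auto simp: ac_simps)
  finally show ?thesis
    by (simp add: gauss_mean_gauss_mean G_def c_def)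
qed

lemma mean_signs_insert:
  fixes F :: "real \<Rightarrow> real"
  assumes "finite T" "t \<notin> T"
  shows "mean (insert t T \<rightarrow>\<^sub>E {-1, 1}) (\<lambda>\<epsilon>. F (x + (\<Sum>i\<in>insert t T. \<epsilon> i * a i)))
       = (mean (T \<rightarrow>\<^sub>E {-1, 1}) (\<lambda>\<epsilon>. F ((x + a t) + (\<Sum>i\<in>T. \<epsilon> i * a i)))
          + mean (T \<rightarrow>\<^sub>E {-1, 1}) (\<lambda>\<epsilon>. F ((x - a t) + (\<Sum>i\<in>T. \<epsilon> i * a i)))) / 2"
proof -
  have "(\<Sum>i\<in>insert t T. (\<epsilon>(t := e)) i * a i) = e * a t + (\<Sum>i\<in>T. \<epsilon> i * a i)" for \<epsilon> and e :: real
    using assms by (auto simp: sum.insert intro!: sum.cong)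
  then show ?thesis
    using assms by (subst mean_PiE_insert') (auto simp: mean_def [of "{-1, 1}"] algebra_simps)
qed

text \<open>
  Random signs are replaced by Gaussian variables one by one. The shift \<open>x\<close> is arbitrary because
  it has to absorb the sign that is being replaced.
\<close>
lemma signs_third_moment_le_gauss_mean:
  fixes a :: "'t \<Rightarrow> real"
  assumes "finite T"
  shows "ennreal (mean (T \<rightarrow>\<^sub>E {-1, 1}) (\<lambda>\<epsilon>. \<bar>x + (\<Sum>t\<in>T. \<epsilon> t * a t)\<bar> ^ 3))
       \<le> gauss_mean (\<lambda>u. ennreal (\<bar>u\<bar> ^ 3)) x (sqrt (\<Sum>t\<in>T. (a t)\<^sup>2))"
  using assms
proof (induction T arbitrary: x rule: finite_induct)
  case empty
  then show ?case by (simp add: mean_def gauss_mean_0)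
next
  case (insert t T)
  define G where "G = gauss_mean (\<lambda>u. ennreal (\<bar>u\<bar> ^ 3))"
  define s where "s = sqrt (\<Sum>i\<in>T. (a i)\<^sup>2)"
  define m where "m x = mean (T \<rightarrow>\<^sub>E {-1, 1}) (\<lambda>\<epsilon>. \<bar>x + (\<Sum>t\<in>T. \<epsilon> t * a t)\<bar> ^ 3)" for x
  have m: "m x \<ge> 0" for x unfolding m_def by (intro mean_nonneg) auto
  have "ennreal (m (x + a t) + m (x - a t)) \<le> G (x + a t) s + G (x - a t) s"
    using insert.IH m by (simp add: ennreal_plus G_def s_def m_def add_mono)
  also have "\<dots> \<le> 2 * G x (sqrt ((a t)\<^sup>2 + s\<^sup>2))"
    unfolding G_def by (rule two_point_gauss_mean_le)
  finally have "ennreal (m (x + a t) + m (x - a t)) / 2 \<le> 2 * G x (sqrt ((a t)\<^sup>2 + s\<^sup>2)) / 2"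
    by (rule divide_right_mono_ennreal)
  also have "\<dots> = G x (sqrt ((a t)\<^sup>2 + s\<^sup>2))"
    by (simp add: ennreal_mult_divide_eq mult.commute [of 2])
  also have "ennreal (m (x + a t) + m (x - a t)) / 2 = ennreal ((m (x + a t) + m (x - a t)) / 2)"
    using m divide_ennreal [of "m (x + a t) + m (x - a t)" 2] by simp
  also have "(m (x + a t) + m (x - a t)) / 2
      = mean (insert t T \<rightarrow>\<^sub>E {-1, 1}) (\<lambda>\<epsilon>. \<bar>x + (\<Sum>i\<in>insert t T. \<epsilon> i * a i)\<bar> ^ 3)"
    unfolding m_def using insert.hyps by (rule mean_signs_insert [symmetric])
  also have "(a t)\<^sup>2 + s\<^sup>2 = (\<Sum>i\<in>insert t T. (a i)\<^sup>2)"
    using insert.hyps by (simp add: s_def sum_nonneg)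
  finally show ?case by (simp add: G_def)
qed

lemma signs_third_moment_le:
  fixes a :: "'t \<Rightarrow> real"
  assumes "finite T"
  shows "mean (T \<rightarrow>\<^sub>E {-1, 1}) (\<lambda>\<epsilon>. \<bar>\<Sum>t\<in>T. \<epsilon> t * a t\<bar> ^ 3)
       \<le> 2 * sqrt (2 / pi) * (\<Sum>t\<in>T. (a t)\<^sup>2) powr (3 / 2)"
proof -
  define s where "s = sqrt (\<Sum>t\<in>T. (a t)\<^sup>2)"
  have s: "s \<ge> 0" by (simp add: s_def sum_nonneg)
  have "has_bochner_integral lborel (\<lambda>g. std_normal_density g * \<bar>g\<bar> ^ 3) (2 * sqrt (2 / pi))"
    using std_normal_moment_abs_odd[of 1] by (simp add: mult.commute)
  then have "(\<integral>\<^sup>+g. ennreal (std_normal_density g * \<bar>g\<bar> ^ 3) \<partial>lborel) = ennreal (2 * sqrt (2 / pi))"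
    by (subst nn_integral_eq_integral) (auto simp: has_bochner_integral_iff)
  moreover have "gauss_mean (\<lambda>u. ennreal (\<bar>u\<bar> ^ 3)) 0 s
      = ennreal (s ^ 3) * (\<integral>\<^sup>+g. ennreal (std_normal_density g * \<bar>g\<bar> ^ 3) \<partial>lborel)"
    unfolding gauss_mean_def using s
    by (subst nn_integral_cmult [symmetric])
       (auto simp: abs_mult power_mult_distrib ennreal_mult' ac_simps intro!: nn_integral_cong)
  ultimately have "ennreal (mean (T \<rightarrow>\<^sub>E {-1, 1}) (\<lambda>\<epsilon>. \<bar>\<Sum>t\<in>T. \<epsilon> t * a t\<bar> ^ 3))
      \<le> ennreal (s ^ 3 * (2 * sqrt (2 / pi)))"
    using signs_third_moment_le_gauss_mean[OF assms, of 0 a] s by (simp add: s_def ennreal_mult')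
  moreover have "s ^ 3 = (\<Sum>t\<in>T. (a t)\<^sup>2) powr (3 / 2)"
  proof (cases "s = 0")
    case False
    then have "s > 0" using s by simp
    moreover have "(\<Sum>t\<in>T. (a t)\<^sup>2) = s\<^sup>2" by (simp add: s_def sum_nonneg)
    ultimately show ?thesis by (simp add: powr_powr flip: powr_numeral)
  qed (simp add: s_def)
  ultimately show ?thesis using s by (simp add: ennreal_le_iff mult.commute)
qed

lemma signs_second_moment:
  fixes a :: "'t \<Rightarrow> real"
  assumes "finite T"
  shows "mean (T \<rightarrow>\<^sub>E {-1, 1}) (\<lambda>\<epsilon>. (x + (\<Sum>t\<in>T. \<epsilon> t * a t))\<^sup>2) = x\<^sup>2 + (\<Sum>t\<in>T. (a t)\<^sup>2)"
  using assms
proof (induction T arbitrary: x rule: finite_induct)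
  case (insert t T)
  show ?case
    using mean_signs_insert[OF insert.hyps, of "\<lambda>u. u\<^sup>2" x a] insert.hyps
    unfolding insert.IH by (simp add: power2_eq_square algebra_simps)
qed (simp add: mean_def)

text \<open>
  Hoelder's inequality for the second moment between the moments of order \<open>p\<close> and 3, that is
  \<open>E f^2 \<le> (E \<bar>f\<bar>^p)^\<theta> (E \<bar>f\<bar>^3)^(1 - \<theta>)\<close> with \<open>\<theta> = 1 / (3 - p)\<close>, raised to the power \<open>3 - p\<close>.
\<close>
lemma mean_square_interpolation:
  fixes f :: "'a \<Rightarrow> real"
  assumes S: "finite S" "S \<noteq> {}" and p: "0 < p" "p < 2"
  shows "mean S (\<lambda>x. (f x)\<^sup>2) powr (3 - p)
       \<le> mean S (\<lambda>x. \<bar>f x\<bar> powr p) * mean S (\<lambda>x. \<bar>f x\<bar> ^ 3) powr (2 - p)"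
proof (cases "\<exists>x\<in>S. f x \<noteq> 0")
  case False
  then have "mean S (\<lambda>x. (f x)\<^sup>2) = 0" "mean S (\<lambda>x. \<bar>f x\<bar> powr p) = 0"
    by (simp_all add: mean_def)
  then show ?thesis by simp
next
  case True
  have pos: "mean S g > 0" if "\<And>x. g x \<ge> 0" "\<And>x. f x \<noteq> 0 \<Longrightarrow> g x > 0" for g
    unfolding mean_def using S that True
    by (intro divide_pos_pos) (auto intro: sum_pos2 simp: card_gt_0_iff)
  define X where "X = mean S (\<lambda>x. \<bar>f x\<bar> powr p)"
  define Y where "Y = mean S (\<lambda>x. \<bar>f x\<bar> ^ 3)"
  have XY: "X > 0" "Y > 0" unfolding X_def Y_def by (rule pos; simp)+
  define \<theta> where "\<theta> = 1 / (3 - p)"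
  have \<theta>: "0 \<le> \<theta>" "0 \<le> 1 - \<theta>" using p by (auto simp: \<theta>_def field_simps)
  have exps: "p * \<theta> + 3 * (1 - \<theta>) = 2"
  proof -
    have "\<theta> * (3 - p) = 1" using p by (simp add: \<theta>_def)
    then show ?thesis by (simp add: algebra_simps)
  qed
  define D where "D = X powr \<theta> * Y powr (1 - \<theta>)"
  have D: "D > 0" using XY by (simp add: D_def)
  have "(f x)\<^sup>2 \<le> D * (\<theta> / X * \<bar>f x\<bar> powr p + (1 - \<theta>) / Y * \<bar>f x\<bar> ^ 3)" for x
  proof (cases "f x = 0")
    case False
    have "(\<bar>f x\<bar> powr p / X) powr \<theta> * (\<bar>f x\<bar> ^ 3 / Y) powr (1 - \<theta>)
        \<le> \<theta> * (\<bar>f x\<bar> powr p / X) + (1 - \<theta>) * (\<bar>f x\<bar> ^ 3 / Y)"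
      using False XY \<theta> by (intro Youngs_inequality_0) auto
    moreover have "(\<bar>f x\<bar> powr p / X) powr \<theta> * (\<bar>f x\<bar> ^ 3 / Y) powr (1 - \<theta>)
        = \<bar>f x\<bar> powr (p * \<theta> + 3 * (1 - \<theta>)) / D"
      using False XY
      by (simp add: powr_divide powr_powr powr_add D_def flip: powr_numeral)
    moreover have "\<bar>f x\<bar> powr (p * \<theta> + 3 * (1 - \<theta>)) = (f x)\<^sup>2"
      unfolding exps using False by (simp add: powr_numeral)
    ultimately show ?thesis using D by (simp add: field_simps)
  qed simp
  then have "mean S (\<lambda>x. (f x)\<^sup>2)
      \<le> mean S (\<lambda>x. D * (\<theta> / X * \<bar>f x\<bar> powr p + (1 - \<theta>) / Y * \<bar>f x\<bar> ^ 3))"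
    by (intro mean_mono)
  also have "\<dots> = D * (\<theta> / X * X + (1 - \<theta>) / Y * Y)"
    by (simp only: mean_add mean_cmult X_def Y_def)
  also have "\<dots> = D" using XY by simp
  finally have "mean S (\<lambda>x. (f x)\<^sup>2) powr (3 - p) \<le> D powr (3 - p)"
    using p by (intro powr_mono2 mean_nonneg) auto
  also have "\<dots> = X * Y powr (2 - p)"
  proof -
    have "\<theta> * (3 - p) = 1" "(1 - \<theta>) * (3 - p) = 2 - p"
      using p by (auto simp: \<theta>_def field_simps)
    then show ?thesis using XY by (simp add: D_def powr_mult powr_powr)
  qed
  finally show ?thesis by (simp add: X_def Y_def)
qed

text \<open>
  Khinchine's inequality, with a constant that tends to 1 at a good rate as \<open>p\<close> tends to 2. The second
  moment of the random sum is known, and the third moment is at most the Gaussian one, so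
  the second moment can be interpolated between the moments of order \<open>p\<close> and 3. The fourth moment in
  place of the third would give 3 instead of \<open>B^2\<close>, and hence growth of order \<open>n powr (ln 3 / 2)\<close>
  for the Bohnenblust--Hille constants, which is too much.
\<close>
lemma Khinchine:
  fixes a :: "'t \<Rightarrow> real"
  assumes T: "finite T" and p: "0 < p" "p < 2" and B: "2 * sqrt (2 / pi) \<le> B"
  shows "(\<Sum>t\<in>T. (a t)\<^sup>2) powr (p / 2)
       \<le> B powr (2 - p) * mean (T \<rightarrow>\<^sub>E {-1, 1}) (\<lambda>\<epsilon>. \<bar>\<Sum>t\<in>T. \<epsilon> t * a t\<bar> powr p)"
proof -
  define s where "s = (\<Sum>t\<in>T. (a t)\<^sup>2)"
  define E where "E = T \<rightarrow>\<^sub>E {-1, 1::real}"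
  define X where "X = mean E (\<lambda>\<epsilon>. \<bar>\<Sum>t\<in>T. \<epsilon> t * a t\<bar> powr p)"
  have B0: "B > 0" using B by (smt (verit) real_sqrt_gt_zero pi_gt_zero divide_pos_pos)
  have X: "X \<ge> 0" unfolding X_def by (intro mean_nonneg) auto
  have "s \<ge> 0" by (simp add: s_def sum_nonneg)
  have "s powr (p / 2) \<le> B powr (2 - p) * X"
  proof (cases "s = 0")
    case False
    with \<open>s \<ge> 0\<close> have s: "s > 0" by simp
    have E: "finite E" "E \<noteq> {}" using T by (auto simp: E_def PiE_eq_empty_iff intro!: finite_PiE)
    have "mean E (\<lambda>\<epsilon>. (\<Sum>t\<in>T. \<epsilon> t * a t)\<^sup>2) = s"
      using signs_second_moment[OF T, of 0 a] by (simp add: s_def E_def)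
    then have "s powr (3 - p) \<le> X * mean E (\<lambda>\<epsilon>. \<bar>\<Sum>t\<in>T. \<epsilon> t * a t\<bar> ^ 3) powr (2 - p)"
      using mean_square_interpolation[OF E p, of "\<lambda>\<epsilon>. \<Sum>t\<in>T. \<epsilon> t * a t"] by (simp add: X_def)
    also have "\<dots> \<le> X * (B * s powr (3 / 2)) powr (2 - p)"
    proof -
      have "mean E (\<lambda>\<epsilon>. \<bar>\<Sum>t\<in>T. \<epsilon> t * a t\<bar> ^ 3) \<le> 2 * sqrt (2 / pi) * s powr (3 / 2)"
        unfolding E_def s_def by (rule signs_third_moment_le[OF T])
      also have "\<dots> \<le> B * s powr (3 / 2)" using B by (intro mult_right_mono) auto
      finally show ?thesis using p X by (intro mult_left_mono powr_mono2 mean_nonneg) auto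
    qed
    also have "\<dots> = (B powr (2 - p) * X) * s powr (3 / 2 * (2 - p))"
      using B0 s by (simp add: powr_mult powr_powr)
    finally have "s powr (3 - p) / s powr (3 / 2 * (2 - p)) \<le> B powr (2 - p) * X"
      using s by (simp add: field_simps)
    moreover have "s powr (3 - p) / s powr (3 / 2 * (2 - p)) = s powr (p / 2)"
    proof -
      have "3 - p - 3 / 2 * (2 - p) = p / 2" by (simp add: field_simps)
      then show ?thesis by (simp only: powr_diff [symmetric])
    qed
    ultimately show ?thesis by simp
  qed (use X in simp)
  then show ?thesis by (simp add: s_def X_def E_def)
qed

section \<open>The Bohnenblust--Hille inequality for coefficient arrays\<close>

text \<open>
  In the notation below, \<open>S k\<close> is the \<open>p\<close>-th power of a mixed norm of the array \<open>a\<close>: an inner Euclidean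
  norm in the index \<open>k\<close> and an outer \<open>p\<close>-norm, \<open>p = 2 d / (d + 1)\<close>, in the other \<open>d\<close> indices. The norm of
  \<open>a\<close> of order \<open>2 (d + 1) / (d + 2)\<close> is at most the geometric mean of the \<open>d + 1\<close> mixed norms.

  For the proof, \<open>\<bar>a i\<bar>^(2 (d + 1))\<close> is written as the product of the \<open>d + 1\<close> functions
  \<open>w k i = (a i)^2 * h k i powr (- 1 / (d + 1))\<close> and the one function \<open>v\<close> that cancels the powers of
  \<open>h k\<close>. The sum of \<open>w k\<close> is exactly \<open>S k\<close>, as one sees by summing over the index \<open>k\<close>
  first. The function \<open>v\<close> is a product of functions each of which ignores one index, so its
  sum is controlled by the Loomis--Whitney inequality, again in terms of the \<open>S k\<close>. Hoelder's
  inequality for \<open>d + 2\<close> factors combines the estimates.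
\<close>
lemma mixed_norm_interpolation:
  fixes a :: "('j \<Rightarrow> nat) \<Rightarrow> real"
  assumes J: "finite J" "card J = Suc d" and d: "d > 0" and N: "N > 0"
  defines "h \<equiv> \<lambda>k i. \<Sum>t<N. (a (i(k := t)))\<^sup>2"
  defines "S \<equiv> \<lambda>k. \<Sum>i\<in>(J - {k}) \<rightarrow>\<^sub>E {..<N}. h k i powr (real d / (real d + 1))"
  shows "(\<Sum>i\<in>J \<rightarrow>\<^sub>E {..<N}. \<bar>a i\<bar> powr (2 * (real d + 1) / (real d + 2)))
       \<le> (\<Prod>k\<in>J. S k) powr ((real d + 1) / (real d * (real d + 2)))"
proof -
  define I where "I = J \<rightarrow>\<^sub>E {..<N}"
  have finI: "finite I" using J by (auto simp: I_def intro!: finite_PiE)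
  have h_nonneg: "h k i \<ge> 0" for k i by (simp add: h_def sum_nonneg)
  have h_upd: "h k (i(k := t)) = h k i" for k i t by (simp add: h_def)
  have S_nonneg: "S k \<ge> 0" for k by (simp add: S_def sum_nonneg)
  define P where "P = (\<Prod>k\<in>J. S k)"
  have P: "P \<ge> 0" unfolding P_def by (intro prod_nonneg) (simp add: S_nonneg)
  have sum_I: "(\<Sum>i\<in>I. f i) = (\<Sum>i\<in>(J - {k}) \<rightarrow>\<^sub>E {..<N}. \<Sum>t<N. f (i(k := t)))"
    if "k \<in> J" for k and f :: "('j \<Rightarrow> nat) \<Rightarrow> real"
    using sum_PiE_insert[of "J - {k}" k f "\<lambda>_. {..<N}"] J that by (simp add: I_def insert_absorb)

  define v where "v i = (\<Prod>k\<in>J. h k i powr (real d / (real d + 1))) powr (1 / real d)" for i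
  define w where "w k i = (a i)\<^sup>2 * h k i powr (- 1 / (real d + 1))" for k i

  have sum_v: "(\<Sum>i\<in>I. v i) \<le> P powr (1 / real d)"
  proof -
    have cI: "card I = N ^ Suc d" using J by (simp add: I_def card_PiE)
    have "mean I v \<le> (\<Prod>k\<in>J. mean I (\<lambda>i. h k i powr (real d / (real d + 1)))) powr (1 / real d)"
      unfolding v_def I_def
    proof (rule Loomis_Whitney_mean)
      show "\<exists>k\<in>J. \<forall>x t. h k (x(j := t)) powr (real d / (real d + 1)) = h k x powr (real d / (real d + 1))"
        if "j \<in> J" for j using that h_upd by metis
    qed (use J d N in auto)
    also have "(\<Prod>k\<in>J. mean I (\<lambda>i. h k i powr (real d / (real d + 1)))) = (\<Prod>k\<in>J. S k / N ^ d)"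
      using N by (intro prod.cong refl) (simp add: mean_def sum_I h_upd cI S_def flip: sum_distrib_left)
    also have "\<dots> = P / (real N ^ Suc d) ^ d"
      by (simp only: prod_dividef P_def prod_constant J power_mult [symmetric] mult.commute of_nat_power)
    also have "\<dots> powr (1 / real d) = P powr (1 / real d) / real N ^ Suc d"
      using P N d by (simp add: powr_divide powr_powr flip: powr_realpow)
    finally show ?thesis using N by (simp add: mean_def cI field_simps)
  qed

  have sum_w: "(\<Sum>i\<in>I. w k i) = S k" if "k \<in> J" for k
  proof -
    have "(\<Sum>t<N. w k (i(k := t))) = h k i powr (real d / (real d + 1))" for i
    proof (cases "h k i = 0")
      case False
      have "(\<Sum>t<N. w k (i(k := t))) = h k i * h k i powr (- 1 / (real d + 1))"
        unfolding w_def h_upd by (simp add: h_def sum_distrib_right)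
      also have "\<dots> = h k i powr (1 + - 1 / (real d + 1))"
        using False h_nonneg[of k i] by (simp only: powr_add) simp
      also have "1 + - 1 / (real d + 1) = real d / (real d + 1)" by (simp add: field_simps)
      finally show ?thesis .
    qed (simp add: w_def h_upd)
    then show ?thesis by (simp add: sum_I[OF that] S_def)
  qed

  \<comment> \<open>The \<open>d + 2\<close> factors: \<open>None\<close> stands for \<open>v\<close> and \<open>Some k\<close> for \<open>w k\<close>.\<close>
  define K where "K = insert None (Some ` J)"
  define u where "u k = (case k of None \<Rightarrow> v | Some k \<Rightarrow> w k)" for k
  have K: "finite K" "K \<noteq> {}" "card K = d + 2"
    using J by (auto simp: K_def card_image)
  have prod_K: "(\<Prod>k\<in>K. f k) = f None * (\<Prod>k\<in>J. f (Some k))" for f :: "'j option \<Rightarrow> real"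
    using J by (simp add: K_def prod.reindex)
  have u_nonneg: "u k i \<ge> 0" for k i by (auto simp: u_def v_def w_def split: option.splits)

  have "\<bar>a i\<bar> powr (2 * (real d + 1) / (real d + 2)) \<le> (\<Prod>k\<in>K. u k i) powr (1 / card K)" if i: "i \<in> I" for i
  proof (cases "a i = 0")
    case False
    \<comment> \<open>At a nonzero entry no \<open>h k i\<close> vanishes, so negative powers cancel as they should.\<close>
    have h_pos: "h k i > 0" if "k \<in> J" for k
    proof -
      have "i k < N" using i that by (auto simp: I_def PiE_def)
      moreover have "(a (i(k := i k)))\<^sup>2 > 0" using False by simp
      ultimately show ?thesis unfolding h_def by (intro sum_pos2[of _ "i k"]) auto
    qed
    define H where "H = (\<Prod>k\<in>J. h k i)"
    have H: "H > 0" unfolding H_def by (intro prod_pos) (use h_pos in auto)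
    have "v i = H powr (1 / (real d + 1))"
      using d H by (simp add: v_def H_def powr_powr prod_powr_distrib h_nonneg)
    moreover have "(\<Prod>k\<in>J. w k i) = ((a i)\<^sup>2) ^ (d + 1) * H powr (- 1 / (real d + 1))"
      using J by (simp add: w_def prod.distrib H_def prod_powr_distrib h_nonneg)
    ultimately have "(\<Prod>k\<in>K. u k i) = ((a i)\<^sup>2) ^ (d + 1)"
      using H by (simp add: prod_K u_def powr_minus)
    also have "\<dots> = \<bar>a i\<bar> powr (2 * (d + 1))"
    proof -
      have "0 < \<bar>a i\<bar>" using False by simp
      then show ?thesis by (simp only: powr_realpow power_mult power2_abs)
    qed
    finally show ?thesis by (simp add: powr_powr K add.commute)
  qed simp
  then have "(\<Sum>i\<in>I. \<bar>a i\<bar> powr (2 * (real d + 1) / (real d + 2)))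
      \<le> (\<Sum>i\<in>I. (\<Prod>k\<in>K. u k i) powr (1 / card K))"
    by (rule sum_mono)
  also have "\<dots> \<le> (\<Prod>k\<in>K. \<Sum>i\<in>I. u k i) powr (1 / card K)"
    using K finI u_nonneg by (intro Holder_sum_prod) auto
  also have "(\<Prod>k\<in>K. \<Sum>i\<in>I. u k i) = (\<Sum>i\<in>I. v i) * P"
    by (simp add: prod_K u_def P_def sum_w)
  also have "\<dots> powr (1 / card K) \<le> (P powr (1 / real d) * P) powr (1 / (real d + 2))"
  proof -
    have "0 \<le> (\<Sum>i\<in>I. v i)" by (intro sum_nonneg) (simp add: v_def)
    moreover have "real (card K) = real d + 2" by (simp add: K)
    ultimately show ?thesis
      using sum_v P by (auto intro!: powr_mono2 mult_right_mono)
  qed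
  also have "\<dots> = P powr ((real d + 1) / (real d * (real d + 2)))"
  proof (cases "P = 0")
    case False
    have "P powr (1 / real d) * P = P powr (1 / real d + 1)" using P by (simp add: powr_add)
    moreover have "(1 / real d + 1) * (1 / (real d + 2)) = (real d + 1) / (real d * (real d + 2))"
      using d by (simp add: field_simps)
    ultimately show ?thesis by (simp add: powr_powr)
  qed simp
  finally show ?thesis by (simp add: I_def P_def)
qed

text \<open>
  The multilinear form with coefficients \<open>a\<close>, with an arbitrary set \<open>J\<close> of slots: when one slot is
  filled with a fixed vector, the remaining slots need not be renumbered.
\<close>
definition coeff_form :: "'j set \<Rightarrow> nat \<Rightarrow> (('j \<Rightarrow> nat) \<Rightarrow> real) \<Rightarrow> ('j \<Rightarrow> nat \<Rightarrow> real) \<Rightarrow> real" where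
  "coeff_form J N a z = (\<Sum>i\<in>J \<rightarrow>\<^sub>E {..<N}. a i * (\<Prod>j\<in>J. z j (i j)))"

lemma coeff_form_insert:
  assumes J: "finite J" "k \<notin> J"
  shows "coeff_form (insert k J) N a (z(k := e)) = coeff_form J N (\<lambda>i. \<Sum>t<N. e t * a (i(k := t))) z"
proof -
  have "(\<Prod>j\<in>insert k J. (z(k := e)) j ((i(k := t)) j)) = e t * (\<Prod>j\<in>J. z j (i j))" for i t
  proof -
    have "(\<Prod>j\<in>J. (z(k := e)) j ((i(k := t)) j)) = (\<Prod>j\<in>J. z j (i j))"
      using J by (intro prod.cong) auto
    then show ?thesis using J by simp
  qed
  then show ?thesis
    unfolding coeff_form_def sum_PiE_insert[OF J]
    by (simp only: sum_distrib_right mult.assoc mult.left_commute)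
qed

text \<open>
  The Bohnenblust--Hille inequality for \<open>m + 1\<close> slots, with the bound \<open>M\<close> required at sign vectors only. The
  induction step fixes a slot \<open>k\<close> and fills it with a vector \<open>e\<close> of signs. The result is a form with one slot
  less and the same bound \<open>M\<close>, whose coefficients \<open>b e i\<close> are random sums in the entries
  \<open>a (i(k := t))\<close>. By Khinchine's inequality, averaging the induction hypothesis over \<open>e\<close>
  bounds the mixed norm with the Euclidean norm in the index \<open>k\<close>, and these mixed norms
  bound the norm in question. A step from \<open>d\<close> to \<open>d + 1\<close> slots costs a factor
  \<open>B powr ((2 - p) / p) = B powr (1 / d)\<close>, whence the harmonic number in the exponent.
\<close>
theorem coeff_Bohnenblust_Hille:
  fixes a :: "('j \<Rightarrow> nat) \<Rightarrow> real"
  assumes N: "N > 0" and B: "2 * sqrt (2 / pi) \<le> B"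
  shows "finite J \<Longrightarrow> card J = Suc m \<Longrightarrow>
    (\<And>z. (\<And>j t. j \<in> J \<Longrightarrow> t < N \<Longrightarrow> z j t \<in> {-1, 1}) \<Longrightarrow> \<bar>coeff_form J N a z\<bar> \<le> M) \<Longrightarrow>
    (\<Sum>i\<in>J \<rightarrow>\<^sub>E {..<N}. \<bar>a i\<bar> powr (2 * (real m + 1) / (real m + 2))) \<le> (B powr harm m * M) powr (2 * (real m + 1) / (real m + 2))"
proof (induction m arbitrary: J a)
  case 0
  then obtain j where J: "J = {j}" by (auto simp: card_1_singleton_iff)
  have B0: "B > 0" using B by (smt (verit) real_sqrt_gt_zero pi_gt_zero divide_pos_pos)
  \<comment> \<open>With one slot, the signs of the coefficients attain the sum of absolute values.\<close>
  define z :: "'j \<Rightarrow> nat \<Rightarrow> real" where "z l t = (if a (restrict (\<lambda>_. t) {j}) \<ge> 0 then 1 else -1)" for l t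
  have "a i * z j (i j) = \<bar>a i\<bar>" if "i \<in> J \<rightarrow>\<^sub>E {..<N}" for i
  proof -
    have "restrict (\<lambda>_. i j) {j} = i" using that by (auto simp: J PiE_def extensional_def)
    then show ?thesis by (simp add: z_def)
  qed
  then have "(\<Sum>i\<in>J \<rightarrow>\<^sub>E {..<N}. \<bar>a i\<bar>) = coeff_form J N a z"
    by (simp add: coeff_form_def J)
  also have "\<bar>coeff_form J N a z\<bar> \<le> M" by (rule "0.prems"(3)) (simp add: z_def)
  then have "coeff_form J N a z \<le> M" by simp
  finally have le: "(\<Sum>i\<in>J \<rightarrow>\<^sub>E {..<N}. \<bar>a i\<bar>) \<le> M" .
  moreover have "0 \<le> (\<Sum>i\<in>J \<rightarrow>\<^sub>E {..<N}. \<bar>a i\<bar>)" by (intro sum_nonneg) auto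
  ultimately show ?case using B0 by (simp add: harm_def)
next
  case (Suc m)
  define d where "d = Suc m"
  have d: "d > 0" "card J = Suc d" using Suc.prems by (simp_all add: d_def)
  have B0: "B > 0" using B by (smt (verit) real_sqrt_gt_zero pi_gt_zero divide_pos_pos)
  have M: "M \<ge> 0"
    using Suc.prems(3)[of "\<lambda>_ _. 1"] by (auto intro: order_trans [OF abs_ge_zero])
  define p :: real where "p = 2 * real d / (real d + 1)"
  have p: "0 < p" "p < 2" using d by (auto simp: p_def field_simps)
  define Q where "Q = B powr (2 - p) * (B powr harm m * M) powr p"
  have Q: "Q \<ge> 0" by (simp add: Q_def)
  define h where "h k i = (\<Sum>t<N. (a (i(k := t)))\<^sup>2)" for k i
  define S where "S k = (\<Sum>i\<in>(J - {k}) \<rightarrow>\<^sub>E {..<N}. h k i powr (real d / (real d + 1)))" for k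
  have S: "S k \<le> Q" if k: "k \<in> J" for k
  proof -
    define E where "E = {..<N} \<rightarrow>\<^sub>E {-1, 1::real}"
    have E: "finite E" "E \<noteq> {}" by (auto simp: E_def PiE_eq_empty_iff intro!: finite_PiE)
    define b where "b e i = (\<Sum>t<N. e t * a (i(k := t)))" for e i
    have slice: "(\<Sum>i\<in>(J - {k}) \<rightarrow>\<^sub>E {..<N}. \<bar>b e i\<bar> powr p) \<le> (B powr harm m * M) powr p"
      if e: "e \<in> E" for e
    proof -
      have bound: "\<bar>coeff_form (J - {k}) N (b e) z\<bar> \<le> M"
        if z: "\<And>j t. j \<in> J - {k} \<Longrightarrow> t < N \<Longrightarrow> z j t \<in> {-1, 1}" for z
      proof -
        have "coeff_form (J - {k}) N (b e) z = coeff_form J N a (z(k := e))"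
          using coeff_form_insert[of "J - {k}" k N a z e] Suc.prems(1) k
          by (simp add: b_def [abs_def] insert_absorb)
        also have "\<bar>\<dots>\<bar> \<le> M"
        proof (rule Suc.prems(3))
          show "(z(k := e)) j t \<in> {-1, 1}" if "j \<in> J" "t < N" for j t
            using that z[of j t] PiE_mem[OF e[unfolded E_def], of t] by auto
        qed
        finally show ?thesis .
      qed
      have "(\<Sum>i\<in>(J - {k}) \<rightarrow>\<^sub>E {..<N}. \<bar>b e i\<bar> powr (2 * (real m + 1) / (real m + 2)))
          \<le> (B powr harm m * M) powr (2 * (real m + 1) / (real m + 2))"
      proof (rule Suc.IH)
        show "finite (J - {k})" "card (J - {k}) = Suc m" using Suc.prems(1,2) k by simp_all
      qed (rule bound)
      moreover have "2 * (real m + 1) / (real m + 2) = p" by (simp add: p_def d_def add.commute)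
      ultimately show ?thesis by simp
    qed
    have "h k i powr (real d / (real d + 1)) \<le> B powr (2 - p) * mean E (\<lambda>e. \<bar>b e i\<bar> powr p)" for i
    proof -
      have "p / 2 = real d / (real d + 1)" by (simp add: p_def field_simps)
      from Khinchine[OF _ p B, of "{..<N}" "\<lambda>t. a (i(k := t))", unfolded this]
      show ?thesis by (simp add: h_def b_def E_def)
    qed
    then have "S k \<le> (\<Sum>i\<in>(J - {k}) \<rightarrow>\<^sub>E {..<N}. B powr (2 - p) * mean E (\<lambda>e. \<bar>b e i\<bar> powr p))"
      unfolding S_def by (intro sum_mono)
    also have "\<dots> = B powr (2 - p) * mean E (\<lambda>e. \<Sum>i\<in>(J - {k}) \<rightarrow>\<^sub>E {..<N}. \<bar>b e i\<bar> powr p)"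
      by (simp add: mean_sum sum_distrib_left)
    also have "\<dots> \<le> Q"
      unfolding Q_def by (intro mult_left_mono mean_le E slice) auto
    finally show ?thesis .
  qed
  have S_nonneg: "S k \<ge> 0" for k by (simp add: S_def sum_nonneg)
  have "(\<Sum>i\<in>J \<rightarrow>\<^sub>E {..<N}. \<bar>a i\<bar> powr (2 * (real d + 1) / (real d + 2)))
       \<le> (\<Prod>k\<in>J. S k) powr ((real d + 1) / (real d * (real d + 2)))"
    unfolding S_def h_def by (rule mixed_norm_interpolation[OF Suc.prems(1) d(2) d(1) N])
  also have "\<dots> \<le> (Q ^ (d + 1)) powr ((real d + 1) / (real d * (real d + 2)))"
  proof -
    have "prod S J \<le> (\<Prod>k\<in>J. Q)" by (intro prod_mono conjI S S_nonneg)
    also have "\<dots> = Q ^ (d + 1)" by (simp add: d)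
    finally show ?thesis by (intro powr_mono2 prod_nonneg S_nonneg) auto
  qed
  also have "\<dots> = (B powr harm d * M) powr (2 * (real d + 1) / (real d + 2))"
  proof (cases "M = 0")
    case False
    then have "M > 0" using M by simp
    have "Q = (B powr ((2 - p) / p) * (B powr harm m * M)) powr p"
      using p B0 \<open>M > 0\<close> by (simp add: Q_def powr_mult powr_powr)
    also have "(2 - p) / p = 1 / real d"
    proof -
      have "2 - p = 2 / (real d + 1)" by (simp add: p_def field_simps)
      also have "\<dots> = p * (1 / real d)" using d by (simp add: p_def)
      finally have "(2 - p) / p = p * (1 / real d) / p" by (rule arg_cong)
      also have "\<dots> = 1 / real d" using p(1) by simp
      finally show ?thesis .
    qed
    also have "B powr (1 / real d) * (B powr harm m * M) = B powr harm d * M"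
      by (simp add: d_def harm_Suc powr_add inverse_eq_divide)
    finally have Q_eq: "Q = (B powr harm d * M) powr p" .
    have "Q > 0" unfolding Q_eq using B0 \<open>M > 0\<close> by simp
    then have "Q ^ (d + 1) = Q powr (real d + 1)"
      using powr_realpow[of Q "d + 1"] by (simp only: of_nat_add of_nat_1)
    then have "(Q ^ (d + 1)) powr ((real d + 1) / (real d * (real d + 2)))
        = Q powr ((real d + 1) * ((real d + 1) / (real d * (real d + 2))))"
      by (simp only: powr_powr)
    also have "\<dots> = (B powr harm d * M) powr (p * ((real d + 1) * ((real d + 1) / (real d * (real d + 2)))))"
      unfolding Q_eq by (simp only: powr_powr)
    also have "p * ((real d + 1) * ((real d + 1) / (real d * (real d + 2)))) = 2 * (real d + 1) / (real d + 2)"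
      using d by (simp add: p_def divide_simps)
    finally show ?thesis .
  qed (simp add: Q_def)
  finally show ?case unfolding d_def .
qed

section \<open>Multilinear forms on real space and the optimal constants\<close>

text \<open>
  The vector \<open>v\<close> is built up coordinate by coordinate, since the definition of multilinearity only
  speaks of combinations of two vectors.
\<close>
lemma multilinear_form_slot:
  assumes U: "multilinear_form n N U" and z: "z \<in> {..<n} \<rightarrow>\<^sub>E carrier_vec N"
    and k: "k < n" and v: "v \<in> carrier_vec N"
  shows "U (z(k := v)) = (\<Sum>t<N. vec_index v t * U (z(k := unit_vec N t)))"
proof -
  have lin: "U (z(k := a \<cdot>\<^sub>v x + b \<cdot>\<^sub>v y)) = a * U (z(k := x)) + b * U (z(k := y))"
    if "x \<in> carrier_vec N" "y \<in> carrier_vec N" for a b x y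
    using U z k that unfolding multilinear_form_def by blast
  define trunc where "trunc m = vec N (\<lambda>t. if t < m then vec_index v t else 0)" for m
  have trunc: "trunc m \<in> carrier_vec N" for m by (simp add: trunc_def)
  have "U (z(k := trunc m)) = (\<Sum>t<m. vec_index v t * U (z(k := unit_vec N t)))" if "m \<le> N" for m
    using that
  proof (induction m)
    case 0
    have "trunc 0 = 0 \<cdot>\<^sub>v v + 0 \<cdot>\<^sub>v v" using v by (auto simp: trunc_def)
    then have "U (z(k := trunc 0)) = 0 * U (z(k := v)) + 0 * U (z(k := v))"
      by (simp only: lin[OF v v])
    then show ?case by (simp del: fun_upd_apply)
  next
    case (Suc m)
    have "trunc (Suc m) = 1 \<cdot>\<^sub>v trunc m + vec_index v m \<cdot>\<^sub>v unit_vec N m"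
      using Suc.prems by (intro eq_vecI) (auto simp: trunc_def unit_vec_def less_Suc_eq)
    then have "U (z(k := trunc (Suc m)))
        = 1 * U (z(k := trunc m)) + vec_index v m * U (z(k := unit_vec N m))"
      by (simp only: lin[OF trunc unit_vec_carrier])
    then show ?case using Suc by (simp del: fun_upd_apply)
  qed
  from this[of N] have "U (z(k := trunc N)) = (\<Sum>t<N. vec_index v t * U (z(k := unit_vec N t)))" by simp
  moreover have "trunc N = v" using v by (auto simp: trunc_def)
  ultimately show ?thesis by simp
qed

text \<open>
  The slots are expanded in the standard basis one after another; \<open>y m i\<close> is the tuple in which the
  first \<open>m\<close> slots already contain basis vectors.
\<close>
lemma multilinear_form_eq_coeff_form:
  assumes U: "multilinear_form n N U" and z: "z \<in> {..<n} \<rightarrow>\<^sub>E carrier_vec N"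
  shows "U z = coeff_form {..<n} N (\<lambda>i. U (\<lambda>k\<in>{..<n}. unit_vec N (i k))) (\<lambda>k t. vec_index (z k) t)"
proof -
  define y where "y m i = (\<lambda>k. if k < m then unit_vec N (i k) else z k)" for m :: nat and i :: "nat \<Rightarrow> nat"
  have "U z = coeff_form {..<m} N (\<lambda>i. U (y m i)) (\<lambda>k t. vec_index (z k) t)" if "m \<le> n" for m
    using that
  proof (induction m)
    case 0
    then show ?case by (simp add: coeff_form_def y_def)
  next
    case (Suc m)
    have ins: "{..<Suc m} = insert m {..<m}" by auto
    have m: "(\<Sum>i\<in>insert m {..<m} \<rightarrow>\<^sub>E {..<N}. f i) = (\<Sum>i\<in>{..<m} \<rightarrow>\<^sub>E {..<N}. \<Sum>t<N. f (i(m := t)))"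
      for f :: "(nat \<Rightarrow> nat) \<Rightarrow> real" by (rule sum_PiE_insert) auto
    have "U (y m i) * P = (\<Sum>t<N. U (y (Suc m) (i(m := t))) * (P * vec_index (z m) t))" for i P
    proof -
      have "y m i \<in> {..<n} \<rightarrow>\<^sub>E carrier_vec N"
        using z Suc.prems by (auto simp: y_def PiE_def extensional_def)
      moreover have "m < n" "z m \<in> carrier_vec N" using Suc.prems PiE_mem[OF z, of m] by simp_all
      ultimately have "U ((y m i)(m := z m)) = (\<Sum>t<N. vec_index (z m) t * U ((y m i)(m := unit_vec N t)))"
        by (rule multilinear_form_slot[OF U])
      moreover have "(y m i)(m := z m) = y m i" by (auto simp: y_def)
      moreover have "(y m i)(m := unit_vec N t) = y (Suc m) (i(m := t))" for t
        by (auto simp: y_def less_Suc_eq)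
      ultimately have "U (y m i) = (\<Sum>t<N. vec_index (z m) t * U (y (Suc m) (i(m := t))))"
        by (simp only:)
      then show ?thesis by (simp only: sum_distrib_left sum_distrib_right mult_ac)
    qed
    moreover have "(\<Prod>k\<in>insert m {..<m}. vec_index (z k) ((i(m := t)) k))
        = (\<Prod>k<m. vec_index (z k) (i k)) * vec_index (z m) t" for i t
    proof -
      have "(\<Prod>k<m. vec_index (z k) ((i(m := t)) k)) = (\<Prod>k<m. vec_index (z k) (i k))"
        by (intro prod.cong) auto
      then show ?thesis by simp
    qed
    moreover have "U z = coeff_form {..<m} N (\<lambda>i. U (y m i)) (\<lambda>k t. vec_index (z k) t)"
      using Suc by simp
    ultimately show ?case
      unfolding coeff_form_def ins m by (simp only:)
  qed
  from this[of n] have "U z = coeff_form {..<n} N (\<lambda>i. U (y n i)) (\<lambda>k t. vec_index (z k) t)" by simp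
  moreover have "y n i = (\<lambda>k\<in>{..<n}. unit_vec N (i k))" for i
    using z by (auto simp: y_def PiE_def extensional_def)
  ultimately show ?thesis by simp
qed

lemma unit_ball_sup_iff:
  assumes "N > 0"
  shows "v \<in> unit_ball_sup N \<longleftrightarrow> v \<in> carrier_vec N \<and> (\<forall>t<N. \<bar>vec_index v t\<bar> < 1)"
proof -
  have "sup_norm v < 1 \<longleftrightarrow> (\<forall>t<N. \<bar>vec_index v t\<bar> < 1)" if "v \<in> carrier_vec N"
    using that assms unfolding sup_norm_def by (subst Max_less_iff) (auto simp: lessThan_empty_iff)
  then show ?thesis by (auto simp: unit_ball_sup_def)
qed

text \<open>
  Suprema of sets of reals that are not bounded above are unspecified, so this is what gives the
  supremum in \<open>BH_inequality\<close> its meaning.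
\<close>
lemma bdd_above_multilinear_form:
  assumes U: "multilinear_form n N U" and N: "N > 0"
  shows "bdd_above ((\<lambda>z. \<bar>U z\<bar>) ` ({..<n} \<rightarrow>\<^sub>E unit_ball_sup N))"
proof -
  define a where "a = (\<lambda>i. U (\<lambda>k\<in>{..<n}. unit_vec N (i k)))"
  have "\<bar>U z\<bar> \<le> (\<Sum>i\<in>{..<n} \<rightarrow>\<^sub>E {..<N}. \<bar>a i\<bar>)" if z: "z \<in> {..<n} \<rightarrow>\<^sub>E unit_ball_sup N" for z
  proof -
    have zc: "z \<in> {..<n} \<rightarrow>\<^sub>E carrier_vec N" using z by (auto simp: PiE_def unit_ball_sup_def)
    have "\<bar>U z\<bar> \<le> (\<Sum>i\<in>{..<n} \<rightarrow>\<^sub>E {..<N}. \<bar>a i * (\<Prod>k<n. vec_index (z k) (i k))\<bar>)"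
      unfolding multilinear_form_eq_coeff_form[OF U zc] coeff_form_def a_def by (rule sum_abs)
    also have "\<dots> \<le> (\<Sum>i\<in>{..<n} \<rightarrow>\<^sub>E {..<N}. \<bar>a i\<bar>)"
    proof (rule sum_mono)
      fix i assume i: "i \<in> {..<n} \<rightarrow>\<^sub>E {..<N}"
      have "\<bar>vec_index (z k) (i k)\<bar> \<le> 1" if "k < n" for k
        using PiE_mem[OF z, of k] PiE_mem[OF i, of k] that N by (auto simp: unit_ball_sup_iff less_imp_le)
      then have "\<bar>\<Prod>k<n. vec_index (z k) (i k)\<bar> \<le> 1"
        unfolding abs_prod by (intro prod_le_1) auto
      then show "\<bar>a i * (\<Prod>k<n. vec_index (z k) (i k))\<bar> \<le> \<bar>a i\<bar>"
        by (simp add: abs_mult mult_left_le)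
    qed
    finally show ?thesis .
  qed
  then show ?thesis by (intro bdd_aboveI2)
qed

lemma abs_multilinear_form_le_SUP:
  assumes "multilinear_form n N U" "N > 0" "z \<in> {..<n} \<rightarrow>\<^sub>E unit_ball_sup N"
  shows "\<bar>U z\<bar> \<le> (SUP z \<in> {..<n} \<rightarrow>\<^sub>E unit_ball_sup N. \<bar>U z\<bar>)"
  using assms by (intro cSUP_upper bdd_above_multilinear_form)

lemma SUP_multilinear_form_nonneg:
  assumes "multilinear_form n N U" "N > 0"
  shows "0 \<le> (SUP z \<in> {..<n} \<rightarrow>\<^sub>E unit_ball_sup N. \<bar>U z\<bar>)"
proof -
  have "(\<lambda>k\<in>{..<n}. 0\<^sub>v N) \<in> {..<n} \<rightarrow>\<^sub>E unit_ball_sup N"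
    using assms(2) by (auto simp: unit_ball_sup_iff)
  from abs_multilinear_form_le_SUP[OF assms this] show ?thesis by linarith
qed

text \<open>
  Vectors of norm at most 1, such as sign vectors, are outside the open unit ball in general; they are
  approached by their multiples with factors \<open>r < 1\<close>.
\<close>
lemma abs_coeff_form_le_SUP:
  assumes U: "multilinear_form n N U" and N: "N > 0"
    and z: "\<And>k t. k < n \<Longrightarrow> t < N \<Longrightarrow> \<bar>z k t\<bar> \<le> 1"
  shows "\<bar>coeff_form {..<n} N (\<lambda>i. U (\<lambda>k\<in>{..<n}. unit_vec N (i k))) z\<bar>
       \<le> (SUP z \<in> {..<n} \<rightarrow>\<^sub>E unit_ball_sup N. \<bar>U z\<bar>)"
    (is "\<bar>?c\<bar> \<le> ?s")
proof -
  have le: "r ^ n * \<bar>?c\<bar> \<le> ?s" if r: "0 < r" "r < 1" for r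
  proof -
    define y where "y = (\<lambda>k\<in>{..<n}. vec N (\<lambda>t. r * z k t))"
    have "\<bar>r * z k t\<bar> < 1" if "k < n" "t < N" for k t
    proof -
      have "\<bar>r * z k t\<bar> = r * \<bar>z k t\<bar>" using r by (simp add: abs_mult)
      also have "\<dots> \<le> r * 1" using z[OF that] r by (intro mult_left_mono) auto
      finally show ?thesis using r by simp
    qed
    then have "vec N (\<lambda>t. r * z k t) \<in> unit_ball_sup N" if "k < n" for k
      using that by (simp add: unit_ball_sup_iff[OF N])
    then have y: "y \<in> {..<n} \<rightarrow>\<^sub>E unit_ball_sup N"
      by (simp add: y_def restrict_PiE_iff)
    then have "y \<in> {..<n} \<rightarrow>\<^sub>E carrier_vec N" by (auto simp: PiE_def unit_ball_sup_def)
    then have "U y = r ^ n * ?c"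
      unfolding multilinear_form_eq_coeff_form[OF U \<open>y \<in> {..<n} \<rightarrow>\<^sub>E carrier_vec N\<close>] coeff_form_def sum_distrib_left
    proof (intro sum.cong refl)
      fix i assume i: "i \<in> {..<n} \<rightarrow>\<^sub>E {..<N}"
      have "(\<Prod>k<n. vec_index (y k) (i k)) = (\<Prod>k<n. r * z k (i k))"
        using i by (intro prod.cong) (auto simp: y_def PiE_def Pi_def)
      then show "U (\<lambda>k\<in>{..<n}. unit_vec N (i k)) * (\<Prod>k<n. vec_index (y k) (i k))
          = r ^ n * (U (\<lambda>k\<in>{..<n}. unit_vec N (i k)) * (\<Prod>k<n. z k (i k)))"
        by (simp add: prod.distrib)
    qed
    then have "\<bar>U y\<bar> = r ^ n * \<bar>?c\<bar>" using r by (simp add: abs_mult)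
    with abs_multilinear_form_le_SUP[OF U N y] show ?thesis by simp
  qed
  have "((\<lambda>r. r ^ n * \<bar>?c\<bar>) \<longlongrightarrow> 1 ^ n * \<bar>?c\<bar>) (at_left 1)"
    by (intro tendsto_mult_right tendsto_power tendsto_ident_at)
  moreover have "eventually (\<lambda>r. r ^ n * \<bar>?c\<bar> \<le> ?s) (at_left (1 :: real))"
    by (rule eventually_mono[OF eventually_at_left_real[of 0 1]]) (auto intro: le)
  ultimately have "1 ^ n * \<bar>?c\<bar> \<le> ?s"
    by (rule tendsto_upperbound) simp
  then show ?thesis by simp
qed

theorem BH_inequality_powr_harm:
  assumes B: "2 * sqrt (2 / pi) \<le> B"
  shows "BH_inequality (Suc m) (B powr harm m)"
  unfolding BH_inequality_def
proof (intro allI impI)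
  fix N U assume N: "0 < N" and U: "multilinear_form (Suc m) N U"
  define n where "n = Suc m"
  define s where "s = (SUP z \<in> {..<n} \<rightarrow>\<^sub>E unit_ball_sup N. \<bar>U z\<bar>)"
  define L where "L = (\<Sum>i\<in>{..<n} \<rightarrow>\<^sub>E {..<N}. \<bar>U (\<lambda>k\<in>{..<n}. unit_vec N (i k))\<bar> powr (2 * real n / (real n + 1)))"
  have s: "s \<ge> 0" using SUP_multilinear_form_nonneg[OF U N] by (simp add: s_def n_def)
  have "(\<Sum>i\<in>{..<n} \<rightarrow>\<^sub>E {..<N}. \<bar>U (\<lambda>k\<in>{..<n}. unit_vec N (i k))\<bar> powr (2 * (real m + 1) / (real m + 2)))
      \<le> (B powr harm m * s) powr (2 * (real m + 1) / (real m + 2))"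
  proof (rule coeff_Bohnenblust_Hille[OF N B])
    show "\<bar>coeff_form {..<n} N (\<lambda>i. U (\<lambda>k\<in>{..<n}. unit_vec N (i k))) z\<bar> \<le> s"
      if "\<And>k t. k \<in> {..<n} \<Longrightarrow> t < N \<Longrightarrow> z k t \<in> {-1, 1}" for z
      unfolding s_def
    proof (rule abs_coeff_form_le_SUP)
      show "multilinear_form n N U" using U by (simp add: n_def)
      show "\<bar>z k t\<bar> \<le> 1" if "k < n" "t < N" for k t
        using \<open>\<And>k t. k \<in> {..<n} \<Longrightarrow> t < N \<Longrightarrow> z k t \<in> {-1, 1}\<close>[of k t] that by auto
    qed (rule N)
  qed (simp_all add: n_def)
  moreover have "2 * real n / (real n + 1) = 2 * (real m + 1) / (real m + 2)" by (simp add: n_def add.commute)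
  ultimately have "L \<le> (B powr harm m * s) powr (2 * real n / (real n + 1))" by (simp add: L_def)
  then have "L powr ((real n + 1) / (2 * real n))
      \<le> ((B powr harm m * s) powr (2 * real n / (real n + 1))) powr ((real n + 1) / (2 * real n))"
  proof (rule powr_mono2[rotated 2])
    show "0 \<le> L" unfolding L_def by (intro sum_nonneg) simp
  qed simp
  also have "\<dots> = B powr harm m * s"
    using s by (simp add: powr_powr n_def)
  finally show "L powr ((real n + 1) / (2 * real n)) \<le> B powr harm m * s" .
qed

text \<open>
  The admissible constants form a closed set that is bounded below, so that the least one exists.
\<close>
lemma BH_const_le:
  assumes C: "1 \<le> C" "BH_inequality n C"
  shows "BH_const n \<le> C"
proof -
  define S where "S = {C. 1 \<le> C \<and> BH_inequality n C}"
  have S: "S \<noteq> {}" "C \<in> S" "bdd_below S"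
    using C by (auto simp: S_def intro!: bdd_belowI[of _ 1])
  have "1 \<le> Inf S" using S by (intro cInf_greatest) (auto simp: S_def)
  moreover have "BH_inequality n (Inf S)"
    unfolding BH_inequality_def
  proof (intro allI impI)
    fix N U assume N: "0 < N" and U: "multilinear_form n N U"
    define s where "s = (SUP z \<in> {..<n} \<rightarrow>\<^sub>E unit_ball_sup N. \<bar>U z\<bar>)"
    define L where "L = (\<Sum>i \<in> {..<n} \<rightarrow>\<^sub>E {..<N}.
            \<bar>U (\<lambda>k\<in>{..<n}. unit_vec N (i k))\<bar> powr (2 * real n / (real n + 1)))
          powr ((real n + 1) / (2 * real n))"
    have L: "L \<le> C * s" if "C \<in> S" for C
    proof -
      have "BH_inequality n C" using that by (simp add: S_def)
      then show ?thesis using N U unfolding BH_inequality_def L_def s_def by blast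
    qed
    have "s \<ge> 0" unfolding s_def by (rule SUP_multilinear_form_nonneg[OF U N])
    then have "L \<le> Inf S * s"
    proof (cases "s = 0")
      case False
      with \<open>s \<ge> 0\<close> have "s > 0" by simp
      then have "L / s \<le> Inf S" using S(1) L by (intro cInf_greatest) (simp_all add: pos_divide_le_eq)
      with \<open>s > 0\<close> show ?thesis by (simp add: pos_divide_le_eq)
    qed (use L[OF S(2)] in simp)
    then show "(\<Sum>i \<in> {..<n} \<rightarrow>\<^sub>E {..<N}.
            \<bar>U (\<lambda>k\<in>{..<n}. unit_vec N (i k))\<bar> powr (2 * real n / (real n + 1)))
          powr ((real n + 1) / (2 * real n))
        \<le> Inf S * (SUP z \<in> {..<n} \<rightarrow>\<^sub>E unit_ball_sup N. \<bar>U z\<bar>)"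
      by (simp add: L_def s_def)
  qed
  ultimately have "BH_const n = Inf S"
    unfolding BH_const_def using S(3)
    by (intro Least_equality) (auto simp: S_def intro: cInf_lower)
  then show ?thesis using S by (simp add: cInf_lower)
qed

section \<open>Numerical estimates and the bounds\<close>

lemma gaussian_third_moment_le: "2 * sqrt (2 / pi) \<le> 1.6"
proof -
  have "2 / pi \<le> 0.64" using pi_approx(1) by (simp add: field_simps)
  then have "sqrt (2 / pi) \<le> sqrt (0.8\<^sup>2)" by (intro real_sqrt_le_mono) (simp add: power2_eq_square)
  then show ?thesis by simp
qed

text \<open>
  This holds because \<open>harm m \<le> 1 + ln m\<close> and \<open>1.6 \<le> exp (1 / 2)\<close>.
\<close>
lemma powr_harm_le_sqrt:
  assumes "m > 0"
  shows "1.6 powr harm m \<le> 1.6 * real m powr (1 / 2)"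
proof -
  have "1.6 \<le> exp (1 / 2 :: real)"
    using exp_lower_Taylor_quadratic[of "1 / 2 :: real"] by (simp add: power2_eq_square)
  then have "ln (1.6 :: real) \<le> ln (exp (1 / 2))" by (subst ln_le_cancel_iff) auto
  then have ln: "ln (1.6 :: real) \<le> 1 / 2" by simp
  have "harm m \<le> 1 + ln (real m)"
    using euler_mascheroni_sequence_decreasing[of 1 m] assms by (simp add: harm_def)
  then have "(1.6 :: real) powr harm m \<le> 1.6 powr (1 + ln (real m))"
    by (intro powr_mono) auto
  also have "\<dots> = 1.6 * real m powr ln 1.6"
    using assms by (simp add: powr_add) (simp add: powr_def mult.commute)
  also have "\<dots> \<le> 1.6 * real m powr (1 / 2)"
    using assms ln by (intro mult_left_mono powr_mono) auto
  finally show ?thesis .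
qed

text \<open>
  All three estimates leave room: numerically the values are about 1.643, 0.121 and 0.526, so crude
  bounds for \<open>ln 2\<close>, \<open>sqrt 2\<close> and the Euler--Mascheroni constant suffice.
\<close>
lemma bound_parameters:
  fixes \<gamma> :: real
  defines "\<gamma> \<equiv> euler_mascheroni"
  shows "1.6 \<le> (2 powr (5/2) - 8 * exp (-1 + \<gamma>/2)) / (2 * log 2 (exp (1 - \<gamma>/2)) - 1)" (is ?D)
    and "0 < C0" (is ?C)
    and "1 / 2 \<le> log 2 (exp (1 - \<gamma>/2) / sqrt 2)" (is ?E)
proof -
  define u l x r L where "u = 1 - \<gamma>/2" and "l = ln (2 :: real)" and "x = exp u"
    and "r = sqrt (2 :: real)" and "L = log 2 x"
  have u: "31/44 < u" "u < 47/66"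
    using euler_mascheroni_gt_19_over_33 euler_mascheroni_less_13_over_22 by (simp_all add: u_def \<gamma>_def)
  have l: "307/443 < l" "l < 4615/6658"
    using ln_approx_bounds[of 2 3] by (simp_all add: l_def eval_nat_numeral)
  have r: "1.41421 \<le> r" "r \<le> 1.41422"
    unfolding r_def by (rule real_le_rsqrt, simp add: power2_eq_square)
      (rule real_le_lsqrt, simp_all add: power2_eq_square)
  have L_eq: "L = u / l" by (simp add: L_def log_def x_def l_def)
  have L: "1.0164 \<le> L" "L \<le> 1.02759"
    using u l by (simp_all add: L_eq field_simps)
  \<comment> \<open>As \<open>u\<close> is close to \<open>ln 2\<close>, linear bounds for the exponential function at \<open>u - l\<close> are precise enough.\<close>
  have x_eq: "x = 2 * exp (u - l)" by (simp add: x_def l_def exp_diff)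
  have x: "2.0227 \<le> x" "x \<le> 2.039"
  proof -
    have "20227 / 20000 \<le> exp (u - l)" using exp_ge_add_one_self[of "u - l"] u l by linarith
    then show "2.0227 \<le> x" by (simp add: x_eq)
    have "7847 / 8000 \<le> exp (- (u - l))" using exp_ge_add_one_self[of "- (u - l)"] u l by linarith
    then have "7847 / 8000 * exp (u - l) \<le> exp (- (u - l)) * exp (u - l)" by (intro mult_right_mono) auto
    also have "\<dots> = 1" by (simp flip: exp_add)
    finally show "x \<le> 2.039" by (simp add: x_eq)
  qed
  have p: "2 powr (5/2) = 4 * r" "2 powr (3/2) = 2 * r" "2 powr (-1/2) = r / 2" "2 powr (-3/2) = r / 4"
  proof -
    have h: "2 powr (1/2) = r" by (simp add: r_def powr_half_sqrt)
    show "2 powr (5/2) = 4 * r" using powr_add[of 2 2 "1/2 :: real"] h by (simp add: powr_numeral)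
    show "2 powr (3/2) = 2 * r" using powr_add[of 2 1 "1/2 :: real"] h by simp
    show "2 powr (-1/2) = r / 2" using powr_add[of 2 "-1" "1/2 :: real"] h by (simp add: powr_minus)
    show "2 powr (-3/2) = r / 4" using powr_add[of 2 "-2" "1/2 :: real"] h by (simp add: powr_minus powr_numeral)
  qed
  have e: "exp (-1 + \<gamma>/2) = 1 / x" "exp (\<gamma>/2 - 1) = 1 / x" "exp (1 - \<gamma>/2) = x"
  proof -
    have "1 / x = exp (- u)" by (simp add: x_def exp_minus divide_inverse)
    then show "exp (-1 + \<gamma>/2) = 1 / x" "exp (\<gamma>/2 - 1) = 1 / x" "exp (1 - \<gamma>/2) = x"
      by (simp_all add: x_def u_def algebra_simps)
  qed
  have xi: "1 / x \<le> 1 / 2.0227" "1 / 2.039 \<le> 1 / x" using x by (simp_all add: field_simps)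
  show ?D
  proof -
    have "1.6 * (2 * L - 1) \<le> 4 * r - 8 * (1 / x)" using L r xi by (simp add: field_simps)
    then show ?thesis unfolding e p L_def [symmetric] using L by (subst pos_le_divide_eq) simp_all
  qed
  show ?C
  proof -
    define A where "A = 2 * r - 4 * (1 / x)"
    have A: "0 \<le> A" "A \<le> 0.8668" using r xi by (simp_all add: A_def)
    define q where "q = r / 2 * x / (L - 1 / 2)"
    have "r * x \<le> 1.41422 * 2.039" using r x by (intro mult_mono) auto
    then have "r / 2 * x \<le> 2.793 * (L - 1 / 2)" using L by simp
    then have q: "q \<le> 2.793" using L by (simp add: q_def field_simps)
    have rx: "1.41421 * 2.0227 \<le> r * x" using r x by (intro mult_mono) auto
    have "A * (q - 1 - r / 4 * x) \<le> A * 1.078" using A q rx by (intro mult_left_mono) auto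
    also have "\<dots> < 1" using A by simp
    finally have "0 < 1 + A * (- q + (1 + r / 4 * x))" by (simp add: algebra_simps)
    also have "- q = r / 2 * x / (2 powr (-1) - L)"
      using L by (simp add: q_def powr_minus divide_simps) (simp add: algebra_simps)
    also have "1 + A * (\<dots> + (1 + r / 4 * x)) = C0"
      unfolding C0_def Let_def \<gamma>_def [symmetric] e p L_def [symmetric] A_def by simp
    finally show ?thesis .
  qed
  show ?E
  proof -
    have "x > 0" by (simp add: x_def)
    then have "log 2 (x / 2 powr (1 / 2)) = L - 1 / 2" by (simp add: log_divide L_def)
    then have "log 2 (x / sqrt 2) = L - 1 / 2" by (simp only: powr_half_sqrt zero_le_numeral)
    then show ?thesis unfolding e using L by simp
  qed
qed

theorem corollary8p5:
  fixes \<gamma> :: real and n :: nat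
  defines "\<gamma> \<equiv> euler_mascheroni"
  assumes "n \<ge> 2"
  shows "BH_const n <
           (2 powr (5/2) - 8 * exp (-1 + \<gamma>/2)) / (2 * log 2 (exp (1 - \<gamma>/2)) - 1)
             * (real n - 1) powr log 2 (exp (1 - \<gamma>/2) / sqrt 2) + C0
         \<and> BH_const n < 1.65 * (real n - 1) powr 0.526322 + 0.13"
proof -
  define m where "m = n - 1"
  have m: "m > 0" "n = Suc m" "real n - 1 = real m" using assms(2) by (simp_all add: m_def)
  have "BH_const n \<le> 1.6 powr harm m"
    unfolding m(2) using gaussian_third_moment_le
    by (intro BH_const_le BH_inequality_powr_harm ge_one_powr_ge_zero harm_nonneg) simp
  also have "\<dots> \<le> 1.6 * real m powr (1 / 2)" by (rule powr_harm_le_sqrt[OF m(1)])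
  finally have K: "BH_const n \<le> 1.6 * real m powr (1 / 2)" .
  have less: "BH_const n < D * (real n - 1) powr \<alpha> + c"
    if "1.6 \<le> D" "1 / 2 \<le> \<alpha>" "0 < c" for D \<alpha> c
  proof -
    have "1.6 * real m powr (1 / 2) \<le> D * real m powr \<alpha>"
      using that m(1) by (intro mult_mono powr_mono) simp_all
    then show ?thesis using K that(3) unfolding m(3) by linarith
  qed
  show ?thesis
    unfolding \<gamma>_def by (intro conjI less bound_parameters) simp_all
qed

end
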